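(* Let $\mathcal{O}$ be a discrete valuation ring and let $\mathfrak{X}_\Sigma$ be the toric scheme over $S=\operatorname{Spec}(\mathcal{O})$ of a fan $\Sigma$ in $N_{\mathbb{R}}\times\mathbb{R}_{\ge 0}$ such that $\operatorname{rec}(\Sigma_1)=\Sigma_0$ is a fan and all vertices of the polyhedral complex $\Sigma_1$ lie in $N\times\{1\}$. Let $\mathcal{E}$ be a toric vector bundle on $\mathfrak{X}_\Sigma$ with corresponding piecewise affine map $\Phi_1=\Phi_{\mathcal{E},1}:|\Sigma_1|\to\widetilde{\mathfrak{B}}_{\mathrm{aff}}(E)$, let $\nu$ be a vertex of $\Sigma_1$, let $\Lambda=\Phi_1(\nu)$, and let $\mathfrak{X}_{s,\nu}$ be the irreducible component of the special fiber corresponding to $\nu$. Let $\Phi_\nu:|\Sigma_1(\nu)|\to\widetilde{\mathfrak{B}}_{\mathrm{sph}}(E_\Lambda)$ be the piecewise linear map obtained by restricting $\Phi_1$ to a small neighborhood of $\nu$ and identifying a small neighborhood of $\Lambda$ in $\widetilde{\mathfrak{B}}_{\mathrm{aff}}(E)$ with a small neighborhood of the origin in $\widetilde{\mathfrak{B}}_{\mathrm{sph}}(E_\Lambda)$. Then $\Phi_\nu$ is the piecewise linear map corresponding to the restriction $\mathcal{E}|_{\mathfrak{X}_{s,\nu}}$, a toric vector bundle on the $T_s$-toric variety $\mathfrak{X}_{s,\nu}$.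
   Context: **Toric schemes.** $\mathcal{O}$ is a discrete valuation ring with fraction field $K$, normalized valuation $\operatorname{val}:K\to\mathbb{Z}\cup\{\infty\}$, uniformizer $\varpi$, residue field $\mathbf{k}$. $M,N$ are dual lattices of rank $n$; $T$ is the split torus over $S$ with character lattice $M$; $T_\eta,T_s$ are its base changes to $K$ and $\mathbf{k}$. Cones, fans and polyhedra are rational and strongly convex. For a cone $\sigma\subset N_{\mathbb{R}}\times\mathbb{R}_{\ge0}$, $R_\sigma=\mathcal{O}[\chi^u\varpi^k : (u,k)\in\sigma^\vee\cap(M\times\mathbb{Z})]\subset K[M]$ and $\mathcal{U}_\sigma=\operatorname{Spec}R_\sigma$; the toric scheme $\mathfrak{X}_\Sigma$ is obtained by gluing the $\mathcal{U}_\sigma$, $\sigma\in\Sigma$. $\Sigma_1$ is the polyhedral complex obtained by intersecting the cones of $\Sigma$ with $N_{\mathbb{R}}\times\{1\}$ (identified with $N_{\mathbb{R}}$), $\Sigma_0$ the fan obtained by intersecting with $N_{\mathbb{R}}\times\{0\}$, and $\operatorname{rec}(\Sigma_1)$ the collection of recession cones of polyhedra of $\Sigma_1$. If $\sigma$ is the cone over $\Delta\in\Sigma_1$ we write $R_\Delta,\mathcal{U}_\Delta$. The point $x_0$ is the $K$-point of the open orbit corresponding to $1\in T_\eta$. For a vertex $\nu$ of $\Sigma_1$, the star $\Sigma_1(\nu)$ is the fan in $N_{\mathbb{R}}$ whose cones are $\Delta_\nu=\mathbb{R}_{\ge0}(\Delta-\nu)$ for $\Delta\in\Sigma_1$ containing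 $\nu$. The irreducible component $\mathfrak{X}_{s,\nu}$ of the special fiber $\mathfrak{X}_s$ corresponding to $\nu$ is the closure of the $T_s$-orbit of $\nu$; it is the $T_s$-toric variety over $\mathbf{k}$ with fan $\Sigma_1(\nu)$. Its affine chart for $\Delta\ni\nu$ is $\operatorname{Spec}\mathbf{k}[\chi^u : (u,-\langle u,\nu\rangle)\in\operatorname{cone}(\Delta)^\vee]$, embedded in $\mathcal{U}_\Delta$ via $\chi^u\varpi^k\mapsto\chi^u$ if $k=-\langle u,\nu\rangle$ and $\mapsto 0$ if $k>-\langle u,\nu\rangle$. Its distinguished point $x_\nu$ in the open orbit is given by $\chi^u\mapsto1$ for all $u\in M$. **Buildings.** Let $E$ be an $r$-dimensional vector space over a field $K$ with valuation $\operatorname{val}$. A level $m$ additive norm ($m\ge0$) is a function $\omega:E\to\mathbb{R}\cup\{\infty\}$ with $\omega(\lambda e)=m\operatorname{val}(\lambda)+\omega(e)$ for $0\ne\lambda\in K$, $\omega(e_1+e_2)\ge\min\{\omega(e_1),\omega(e_2)\}$, and $\omega(e)=\infty$ iff $e=0$. Level $1$ ones are called additive norms, level $0$ ones valuations (the latter make sense over any field). $\widetilde{\mathfrak{B}}_{\mathrm{aff}}(E)$ is the set of additive norms, $\widetilde{\mathfrak{B}}_{\mathrm{sph}}(E)$ the set of valuations, and $\widetilde{\mathfrak{B}}(E)$ the union over $m\geq 0$ of the sets $\widetilde{\mathfrak{B}}_m(E)$ of level $m$ additive norms. $\omega$ of level $m$ is adapted to a basis $b_1,\dots,b_r$ if $\omega(\sum\lambda_ib_i)=\min\{m\operatorname{val}(\lambda_i)+\omega(b_i):\lambda_i\ne0\}$;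 the extended apartment of the basis is the set of all $\omega$ adapted to it, identified (at level $m$) with $\mathbb{R}^r$ via $\omega\mapsto(\omega(b_i))_i$. A map from the support of a fan to $\widetilde{\mathfrak{B}}_{\mathrm{sph}}$ is piecewise linear if each cone is mapped into one extended apartment by (the restriction of) a linear map; a map from $|\Sigma_1|$ to $\widetilde{\mathfrak{B}}_{\mathrm{aff}}$ is piecewise affine if each polyhedron is mapped into one extended apartment by an affine map. An $\mathcal{O}$-lattice $\Lambda\subset E$ (finitely generated $\mathcal{O}$-submodule of full rank) is identified with the integer valued additive norm $\omega_\Lambda(e)=\max\{j: e\in\varpi^j\Lambda\}$; conversely an integer valued $\omega$ corresponds to $\{e:\omega(e)\ge0\}$. Put $E_\Lambda=\Lambda\otimes_{\mathcal{O}}\mathbf{k}=\Lambda/\varpi\Lambda$. **Link identification.** For an additive norm $\omega$ close to $\omega_\Lambda$, $\omega$ and $\omega_\Lambda$ are both adapted to a common $\mathcal{O}$-basis $b_1,\dots,b_r$ of $\Lambda$, and $\omega$ is identified with the valuation $\overline\omega$ on $E_\Lambda$ adapted to the image basis $\overline b_1,\dots,\overline b_r$ with $\overline\omega(\overline b_i)=\omega(b_i)$. Equivalently, $\overline\omega(\overline e)=\max\{\omega(e'): e'\in\Lambda \text{ a lift of }\overline e\}$ for $\overline e\neq 0$, so this does not depend on the basis. **Definition of $\Phi_\nu$.** For $v\in|\Sigma_1(\nu)|$ and all sufficiently small $\varepsilon>0$, $\Phi_\nu(v)=\varepsilon^{-1}\,\overline{\Phi_1(\nu+\varepsilon v)}\in\widetilde{\mathfrak{B}}_{\mathrm{sph}}(E_\Lambda)$.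 **Toric vector bundles and their maps.** A toric vector bundle is a $T$-linearized vector bundle $\mathcal{E}$; $E=\mathcal{E}_{x_0}$ is its fiber at $x_0$. Sections over the open orbit are identified with $K[M]\otimes_KE$ via $s\mapsto(t\mapsto t^{-1}s(t x_0))$. - Over a DVR: for each $\sigma\in\Sigma$ there are a $K$-basis $b_{\sigma,1},\dots,b_{\sigma,r}$ of $E$ and $u_{\sigma,1},\dots,u_{\sigma,r}\in M$ with $H^0(\mathcal{U}_\sigma,\mathcal{E})=\bigoplus_iR_\sigma\,\chi^{-u_{\sigma,i}}b_{\sigma,i}$. The corresponding graded piecewise linear map $\Phi_{\mathcal{E}}:|\Sigma|\to\widetilde{\mathfrak{B}}(E)$ sends $(x,m)\in\sigma$ to the level $m$ additive norm $\sum\lambda_ib_{\sigma,i}\mapsto\min\{m\operatorname{val}(\lambda_i)+\langle u_{\sigma,i},x\rangle:\lambda_i\ne0\}$. $\Phi_{\mathcal{E},1}$ is its restriction to $|\Sigma_1|$. Since vertices $\nu$ are lattice points, $\Phi_1(\nu)$ is integer valued, hence an $\mathcal{O}$-lattice $\Lambda$, and $H^0(\mathcal{U}_\nu,\mathcal{E})=\sum_{u\in M}\chi^u\varpi^{-\langle u,\nu\rangle}\Lambda$. - Over a field $F$: for a toric variety $X_\Omega$ with affine charts $U_\sigma$ and a toric vector bundle with fiber $E$ at the distinguished point of the open orbit, there are bases and characters with $H^0(U_\sigma,\mathcal{E})=\bigoplus_iF[\sigma^\vee\cap M]\,\chi^{-u_{\sigma,i}}b_{\sigma,i}\subset F[M]\otimes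 E$, and the corresponding piecewise linear map $|\Omega|\to\widetilde{\mathfrak{B}}_{\mathrm{sph}}(E)$ sends $x\in\sigma$ to the valuation adapted to $(b_{\sigma,i})$ with $b_{\sigma,i}\mapsto\langle u_{\sigma,i},x\rangle$. The fiber $\mathcal{E}_{x_\nu}=H^0(\mathcal{U}_\nu,\mathcal{E})\otimes_{R_\nu}\mathbf{k}$ (via $R_\nu\to\mathcal{O}\to\mathbf{k}$, $\chi^u\varpi^{-\langle u,\nu\rangle}\mapsto1$) is identified with $E_\Lambda$ by sending $\chi^u\varpi^{-\langle u,\nu\rangle}\lambda$ ($\lambda\in\Lambda$) to the class of $\lambda$. *)

theory Defs
  imports "HOL-Analysis.Analysis" "HOL-Library.Poly_Mapping"
begin

section \<open>Lattices, cones, fans\<close>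

text \<open>
  The type \<open>'m\<close> is the character lattice \<open>M\<close>, the type \<open>'v\<close> is \<open>N\<^sub>\<real>\<close>, and \<open>pr u x\<close> is the pairing
  \<open>\<langle>u, x\<rangle>\<close>. The assumption asks for dual bases \<open>b\<close>, \<open>d\<close>: then \<open>M \<cong> \<int>\<^sup>n\<close> via \<open>u \<mapsto> (\<langle>u, d\<^sub>i\<rangle>)\<^sub>i\<close>, the vectors
  \<open>d\<^sub>i\<close> are an \<open>\<real>\<close>-basis of \<open>N\<^sub>\<real>\<close>, and \<open>N = {x. \<forall>u\<in>M. \<langle>u, x\<rangle> \<in> \<int>}\<close> is their \<open>\<int>\<close>-span.
  The case \<open>n = 0\<close> is allowed.
\<close>

locale dual_lattices =
  fixes n :: nat and pr :: "'m::ab_group_add \<Rightarrow> 'v::real_vector \<Rightarrow> real"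
  assumes pr_add_left: "pr (u + u') x = pr u x + pr u' x"
    and pr_linear: "linear (pr u)"
    and ex_dual_bases: "\<exists>b d.
          (\<forall>i<n. \<forall>j<n. pr (b i) (d j) = (if i = j then 1 else 0)) \<and>
          (\<forall>u. \<forall>j<n. pr u (d j) \<in> \<int>) \<and>
          (\<forall>u u'. (\<forall>j<n. pr u (d j) = pr u' (d j)) \<longrightarrow> u = u') \<and>
          (\<forall>x. x = (\<Sum>i<n. pr (b i) x *\<^sub>R d i))"

definition lattice_N :: "('m \<Rightarrow> 'v \<Rightarrow> real) \<Rightarrow> 'v set" where
  "lattice_N pr = {x. \<forall>u. pr u x \<in> \<int>}"

definition lattice_NZ :: "('m \<Rightarrow> 'v \<Rightarrow> real) \<Rightarrow> ('v \<times> real) set" where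
  "lattice_NZ pr = lattice_N pr \<times> \<int>"

definition rational_cone :: "'w::real_vector set \<Rightarrow> 'w set \<Rightarrow> bool" where
  "rational_cone L \<sigma> \<longleftrightarrow> (\<exists>G. finite G \<and> G \<subseteq> L \<and> \<sigma> = convex_cone hull G)"

definition strongly_convex :: "'w::real_vector set \<Rightarrow> bool" where
  "strongly_convex \<sigma> \<longleftrightarrow> (\<forall>x. x \<in> \<sigma> \<and> - x \<in> \<sigma> \<longrightarrow> x = 0)"

text \<open>The library's \<^term>\<open>(face_of)\<close> counts the empty set as a face; it is excluded here.\<close>

definition fan :: "'w::real_vector set \<Rightarrow> 'w set set \<Rightarrow> bool" where
  "fan L \<Omega> \<longleftrightarrow> finite \<Omega> \<and> \<Omega> \<noteq> {} \<and>
     (\<forall>\<sigma>\<in>\<Omega>. rational_cone L \<sigma> \<and> strongly_convex \<sigma>) \<and>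
     (\<forall>\<sigma>\<in>\<Omega>. \<forall>\<tau>. \<tau> face_of \<sigma> \<and> \<tau> \<noteq> {} \<longrightarrow> \<tau> \<in> \<Omega>) \<and>
     (\<forall>\<sigma>\<in>\<Omega>. \<forall>\<tau>\<in>\<Omega>. \<sigma> \<inter> \<tau> face_of \<sigma> \<and> \<sigma> \<inter> \<tau> face_of \<tau>)"

definition slice :: "real \<Rightarrow> ('v \<times> real) set \<Rightarrow> 'v set" where
  "slice t \<sigma> = {x. (x, t) \<in> \<sigma>}"

definition Sigma0 :: "('v \<times> real) set set \<Rightarrow> 'v set set" where
  "Sigma0 \<Sigma> = slice 0 ` \<Sigma>"

definition Sigma1 :: "('v \<times> real) set set \<Rightarrow> 'v set set" where
  "Sigma1 \<Sigma> = slice 1 ` \<Sigma> - {{}}"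

definition recession_cone :: "'v::real_vector set \<Rightarrow> 'v set" where
  "recession_cone \<Delta> = {w. \<forall>x\<in>\<Delta>. \<forall>t\<ge>0. x + t *\<^sub>R w \<in> \<Delta>}"

definition cone_over :: "('v \<times> real) set set \<Rightarrow> 'v set \<Rightarrow> ('v \<times> real) set" where
  "cone_over \<Sigma> \<Delta> = (THE \<sigma>. \<sigma> \<in> \<Sigma> \<and> slice 1 \<sigma> = \<Delta>)"

definition star_cone :: "'v::real_vector \<Rightarrow> 'v set \<Rightarrow> 'v set" where
  "star_cone \<nu> \<Delta> = {t *\<^sub>R (x - \<nu>) | t x. 0 \<le> t \<and> x \<in> \<Delta>}"

definition star :: "('v::real_vector \<times> real) set set \<Rightarrow> 'v \<Rightarrow> 'v set set" where
  "star \<Sigma> \<nu> = star_cone \<nu> ` {\<Delta> \<in> Sigma1 \<Sigma>. \<nu> \<in> \<Delta>}"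


section \<open>Discrete valuation rings\<close>

text \<open>
  A discrete valuation ring is given by its fraction field (the type \<open>'k\<close>) with the normalized
  valuation. Only the values of \<open>val\<close> on nonzero elements are meaningful (\<open>val 0 = \<infinity>\<close> in the usual
  convention); \<open>\<pi>\<close> is a uniformizer.
\<close>

locale discrete_valuation =
  fixes val :: "'k::field \<Rightarrow> int" and \<pi> :: 'k
  assumes val_mult: "x \<noteq> 0 \<Longrightarrow> y \<noteq> 0 \<Longrightarrow> val (x * y) = val x + val y"
    and val_add: "x \<noteq> 0 \<Longrightarrow> y \<noteq> 0 \<Longrightarrow> x + y \<noteq> 0 \<Longrightarrow> min (val x) (val y) \<le> val (x + y)"
    and unif_nonzero: "\<pi> \<noteq> 0"
    and val_unif: "val \<pi> = 1"

definition valring :: "('k::field \<Rightarrow> int) \<Rightarrow> 'k set" where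
  "valring val = {x. x = 0 \<or> 0 \<le> val x}"

text \<open>\<open>res\<close> exhibits the field \<open>'f\<close> as the residue field; its values outside \<open>\<O>\<close> are irrelevant.\<close>

definition residue_map :: "('k::field \<Rightarrow> int) \<Rightarrow> ('k \<Rightarrow> 'f::field) \<Rightarrow> bool" where
  "residue_map val res \<longleftrightarrow>
     (\<forall>x\<in>valring val. \<forall>y\<in>valring val. res (x + y) = res x + res y \<and> res (x * y) = res x * res y) \<and>
     res 1 = 1 \<and> res ` valring val = UNIV \<and>
     (\<forall>x\<in>valring val. res x = 0 \<longleftrightarrow> x = 0 \<or> 0 < val x)"


section \<open>Additive norms and apartments\<close>

definition is_basis :: "('k::field \<Rightarrow> 'e::ab_group_add \<Rightarrow> 'e) \<Rightarrow> nat \<Rightarrow> (nat \<Rightarrow> 'e) \<Rightarrow> bool" where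
  "is_basis s r b \<longleftrightarrow> inj_on b {..<r} \<and> \<not> module.dependent s (b ` {..<r}) \<and>
     module.span s (b ` {..<r}) = UNIV"

definition additive_norm ::
  "('k::field \<Rightarrow> int) \<Rightarrow> ('k \<Rightarrow> 'e::ab_group_add \<Rightarrow> 'e) \<Rightarrow> real \<Rightarrow> ('e \<Rightarrow> ereal) \<Rightarrow> bool" where
  "additive_norm val s m \<omega> \<longleftrightarrow>
     (\<forall>e. \<omega> e \<noteq> -\<infinity>) \<and>
     (\<forall>c e. c \<noteq> 0 \<longrightarrow> \<omega> (s c e) = ereal (m * of_int (val c)) + \<omega> e) \<and>
     (\<forall>e e'. min (\<omega> e) (\<omega> e') \<le> \<omega> (e + e')) \<and>
     (\<forall>e. \<omega> e = \<infinity> \<longleftrightarrow> e = 0)"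

text \<open>
  The level \<open>m\<close> part of the extended apartment of \<open>b\<close>. The infimum is over a finite set; it is the
  minimum if this set is nonempty and \<open>\<infinity>\<close> otherwise.
\<close>

definition apartment ::
  "('k::field \<Rightarrow> int) \<Rightarrow> ('k \<Rightarrow> 'e::ab_group_add \<Rightarrow> 'e) \<Rightarrow> real \<Rightarrow> nat \<Rightarrow> (nat \<Rightarrow> 'e) \<Rightarrow> ('e \<Rightarrow> ereal) set" where
  "apartment val s m r b = {\<omega>. additive_norm val s m \<omega> \<and>
     (\<forall>c. \<omega> (\<Sum>i<r. s (c i) (b i)) =
        (INF i\<in>{i. i < r \<and> c i \<noteq> 0}. ereal (m * of_int (val (c i))) + \<omega> (b i)))}"

text \<open>At level \<open>0\<close> the valuation of the field does not enter, so over any field the zero function serves.\<close>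

abbreviation valuation :: "('k::field \<Rightarrow> 'e::ab_group_add \<Rightarrow> 'e) \<Rightarrow> ('e \<Rightarrow> ereal) \<Rightarrow> bool" where
  "valuation s \<equiv> additive_norm (\<lambda>_. 0) s 0"

abbreviation apartment_sph ::
  "('k::field \<Rightarrow> 'e::ab_group_add \<Rightarrow> 'e) \<Rightarrow> nat \<Rightarrow> (nat \<Rightarrow> 'e) \<Rightarrow> ('e \<Rightarrow> ereal) set" where
  "apartment_sph s r b \<equiv> apartment (\<lambda>_. 0) s 0 r b"

definition piecewise_linear ::
  "('k::field \<Rightarrow> 'e::ab_group_add \<Rightarrow> 'e) \<Rightarrow> nat \<Rightarrow> 'v::real_vector set set \<Rightarrow> ('v \<Rightarrow> 'e \<Rightarrow> ereal) \<Rightarrow> bool" where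
  "piecewise_linear s r \<Omega> \<Psi> \<longleftrightarrow> (\<forall>\<sigma>\<in>\<Omega>. \<exists>b l. is_basis s r b \<and> (\<forall>i<r. linear (l i)) \<and>
     (\<forall>x\<in>\<sigma>. \<Psi> x \<in> apartment_sph s r b \<and> (\<forall>i<r. \<Psi> x (b i) = ereal (l i x))))"

definition lattice_of :: "('e \<Rightarrow> ereal) \<Rightarrow> 'e set" where
  "lattice_of \<omega> = {e. 0 \<le> \<omega> e}"

definition lattice_basis ::
  "('k::field \<Rightarrow> int) \<Rightarrow> ('k \<Rightarrow> 'e::ab_group_add \<Rightarrow> 'e) \<Rightarrow> nat \<Rightarrow> 'e set \<Rightarrow> (nat \<Rightarrow> 'e) \<Rightarrow> bool" where
  "lattice_basis val s r \<Lambda> b \<longleftrightarrow> is_basis s r b \<and>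
     \<Lambda> = {\<Sum>i<r. s (a i) (b i) | a. \<forall>i<r. a i \<in> valring val}"

text \<open>
  \<open>q\<close> exhibits the vector space \<open>('g, sg)\<close> over the residue field as \<open>E\<^sub>\<Lambda> = \<Lambda> / \<pi>\<Lambda>\<close>; its values outside
  \<open>\<Lambda>\<close> are irrelevant.
\<close>

definition lattice_reduction ::
  "('k::field \<Rightarrow> int) \<Rightarrow> 'k \<Rightarrow> ('k \<Rightarrow> 'f::field) \<Rightarrow> ('k \<Rightarrow> 'e::ab_group_add \<Rightarrow> 'e) \<Rightarrow>
   ('f \<Rightarrow> 'g::ab_group_add \<Rightarrow> 'g) \<Rightarrow> 'e set \<Rightarrow> ('e \<Rightarrow> 'g) \<Rightarrow> bool" where
  "lattice_reduction val \<pi> res s sg \<Lambda> q \<longleftrightarrow>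
     (\<forall>e\<in>\<Lambda>. \<forall>e'\<in>\<Lambda>. q (e + e') = q e + q e') \<and>
     (\<forall>a\<in>valring val. \<forall>e\<in>\<Lambda>. q (s a e) = sg (res a) (q e)) \<and>
     q ` \<Lambda> = UNIV \<and>
     (\<forall>e\<in>\<Lambda>. q e = 0 \<longleftrightarrow> e \<in> s \<pi> ` \<Lambda>)"

text \<open>
  \<open>\<omega>\<close> near \<open>\<omega>\<^sub>\<Lambda>\<close> is identified with \<open>\<omega>'\<close>. (\<open>\<omega>\<^sub>\<Lambda>\<close> is adapted to every \<open>\<O>\<close>-basis of \<open>\<Lambda>\<close>, so only
  \<open>\<omega>\<close> has to be required to be adapted to \<open>b\<close>.)
\<close>

definition link_identified ::
  "('k::field \<Rightarrow> int) \<Rightarrow> ('k \<Rightarrow> 'e::ab_group_add \<Rightarrow> 'e) \<Rightarrow> ('f::field \<Rightarrow> 'g::ab_group_add \<Rightarrow> 'g) \<Rightarrow>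
   nat \<Rightarrow> 'e set \<Rightarrow> ('e \<Rightarrow> 'g) \<Rightarrow> ('e \<Rightarrow> ereal) \<Rightarrow> ('g \<Rightarrow> ereal) \<Rightarrow> bool" where
  "link_identified val s sg r \<Lambda> q \<omega> \<omega>' \<longleftrightarrow> (\<exists>b. lattice_basis val s r \<Lambda> b \<and>
     \<omega> \<in> apartment val s 1 r b \<and> \<omega>' \<in> apartment_sph sg r (q \<circ> b) \<and> (\<forall>i<r. \<omega>' (q (b i)) = \<omega> (b i)))"

text \<open>\<open>\<Phi>\<^sub>\<nu>(v) = \<epsilon>\<^sup>-\<^sup>1 \<cdot> (\<Phi>\<^sub>1(\<nu> + \<epsilon>v))\<close>, transported to the link, for all sufficiently small \<open>\<epsilon> > 0\<close>.\<close>

definition link_map ::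
  "('k::field \<Rightarrow> int) \<Rightarrow> ('k \<Rightarrow> 'e::ab_group_add \<Rightarrow> 'e) \<Rightarrow> ('f::field \<Rightarrow> 'g::ab_group_add \<Rightarrow> 'g) \<Rightarrow>
   nat \<Rightarrow> 'e set \<Rightarrow> ('e \<Rightarrow> 'g) \<Rightarrow> ('v::real_vector \<Rightarrow> 'e \<Rightarrow> ereal) \<Rightarrow> 'v \<Rightarrow> 'v \<Rightarrow> 'g \<Rightarrow> ereal" where
  "link_map val s sg r \<Lambda> q \<Phi>1 \<nu> v = (THE \<phi>. \<forall>\<^sub>F \<epsilon> in at_right 0. \<exists>\<omega>'.
     link_identified val s sg r \<Lambda> q (\<Phi>1 (\<nu> + \<epsilon> *\<^sub>R v)) \<omega>' \<and> \<phi> = (\<lambda>e. ereal (inverse \<epsilon>) * \<omega>' e))"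


section \<open>Toric vector bundles\<close>

text \<open>
  \<open>K[M]\<close> is the library's \<open>'m \<Rightarrow>\<^sub>0 'k\<close> with its convolution product, \<open>K[M] \<otimes> E\<close> is the group
  \<open>'m \<Rightarrow>\<^sub>0 'e\<close>, where \<open>Poly_Mapping.single u e\<close> stands for \<open>\<chi>\<^sup>u \<otimes> e\<close>; \<open>act s\<close> is the scalar multiplication.
\<close>

definition act ::
  "('k::field \<Rightarrow> 'e::ab_group_add \<Rightarrow> 'e) \<Rightarrow> ('m::ab_group_add \<Rightarrow>\<^sub>0 'k) \<Rightarrow> ('m \<Rightarrow>\<^sub>0 'e) \<Rightarrow> ('m \<Rightarrow>\<^sub>0 'e)" where
  "act s f h = (\<Sum>u\<in>Poly_Mapping.keys f. \<Sum>w\<in>Poly_Mapping.keys h.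
     Poly_Mapping.single (u + w) (s (Poly_Mapping.lookup f u) (Poly_Mapping.lookup h w)))"

text \<open>\<open>R\<^sub>\<sigma> = \<O>[\<chi>\<^sup>u\<pi>\<^sup>k : (u,k) \<in> \<sigma>\<^sup>\<or> \<inter> (M \<times> \<int>)]\<close>\<close>

inductive_set chart_ring ::
  "('m::ab_group_add \<Rightarrow> 'v \<Rightarrow> real) \<Rightarrow> ('k::field \<Rightarrow> int) \<Rightarrow> 'k \<Rightarrow> ('v \<times> real) set \<Rightarrow> ('m \<Rightarrow>\<^sub>0 'k) set"
  for pr val \<pi> \<sigma> where
  scalar: "a \<in> valring val \<Longrightarrow> Poly_Mapping.single 0 a \<in> chart_ring pr val \<pi> \<sigma>"
| monomial: "(\<forall>(x, t)\<in>\<sigma>. 0 \<le> pr u x + of_int k * t) \<Longrightarrow>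
    Poly_Mapping.single u (\<pi> powi k) \<in> chart_ring pr val \<pi> \<sigma>"
| add: "f \<in> chart_ring pr val \<pi> \<sigma> \<Longrightarrow> g \<in> chart_ring pr val \<pi> \<sigma> \<Longrightarrow> f + g \<in> chart_ring pr val \<pi> \<sigma>"
| mult: "f \<in> chart_ring pr val \<pi> \<sigma> \<Longrightarrow> g \<in> chart_ring pr val \<pi> \<sigma> \<Longrightarrow> f * g \<in> chart_ring pr val \<pi> \<sigma>"

text \<open>\<open>F[\<sigma>\<^sup>\<or> \<inter> M]\<close>, the coordinate ring of an affine chart of a toric variety over a field\<close>

definition chart_ring_field ::
  "('m::ab_group_add \<Rightarrow> 'v \<Rightarrow> real) \<Rightarrow> 'v set \<Rightarrow> ('m \<Rightarrow>\<^sub>0 'f::field) set" where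
  "chart_ring_field pr \<sigma> = {f. \<forall>u\<in>Poly_Mapping.keys f. \<forall>x\<in>\<sigma>. 0 \<le> pr u x}"

definition submodule ::
  "('k::field \<Rightarrow> 'e::ab_group_add \<Rightarrow> 'e) \<Rightarrow> ('m::ab_group_add \<Rightarrow>\<^sub>0 'k) set \<Rightarrow> ('m \<Rightarrow>\<^sub>0 'e) set \<Rightarrow> bool" where
  "submodule s R H \<longleftrightarrow> 0 \<in> H \<and> (\<forall>h\<in>H. \<forall>h'\<in>H. h + h' \<in> H) \<and> (\<forall>f\<in>R. \<forall>h\<in>H. act s f h \<in> H)"

text \<open>All finite sums \<open>\<Sum> f\<^sub>x x\<close> with \<open>f\<^sub>x \<in> R\<close>, \<open>x \<in> X\<close>; here \<open>R\<close> is a subring of \<open>K[M]\<close> or an ideal in one.\<close>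

definition combinations ::
  "('k::field \<Rightarrow> 'e::ab_group_add \<Rightarrow> 'e) \<Rightarrow> ('m::ab_group_add \<Rightarrow>\<^sub>0 'k) set \<Rightarrow> ('m \<Rightarrow>\<^sub>0 'e) set \<Rightarrow> ('m \<Rightarrow>\<^sub>0 'e) set" where
  "combinations s R X = {\<Sum>x\<in>Y. act s (f x) x | Y f. finite Y \<and> Y \<subseteq> X \<and> f ` Y \<subseteq> R}"

text \<open>
  \<open>H\<close> is locally free of rank \<open>r\<close> over \<open>R\<close>: the spectrum of \<open>R\<close> is covered by basic open sets \<open>D(f)\<close>,
  \<open>f \<in> F\<close>, on each of which \<open>H\<^sub>f\<close> has an \<open>R\<^sub>f\<close>-basis \<open>h\<^sub>0, \<dots>, h\<^sub>r\<^sub>-\<^sub>1\<close>, taken in \<open>H\<close> after clearing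
  denominators. As \<open>H\<close> lies in \<open>K[M] \<otimes> E\<close> and is torsion-free, denominators can be cleared in the linear
  independence as well.
\<close>

definition locally_free ::
  "('k::field \<Rightarrow> 'e::ab_group_add \<Rightarrow> 'e) \<Rightarrow> nat \<Rightarrow> ('m::ab_group_add \<Rightarrow>\<^sub>0 'k) set \<Rightarrow> ('m \<Rightarrow>\<^sub>0 'e) set \<Rightarrow> bool" where
  "locally_free s r R H \<longleftrightarrow> (\<exists>F. finite F \<and> F \<subseteq> R \<and>
     (\<exists>a. a ` F \<subseteq> R \<and> (\<Sum>f\<in>F. a f * f) = 1) \<and>
     (\<forall>f\<in>F. \<exists>h. (\<forall>i<r. h i \<in> H) \<and>
        (\<forall>x\<in>H. \<exists>k c. (\<forall>i<r. c i \<in> R) \<and> act s (f ^ k) x = (\<Sum>i<r. act s (c i) (h i))) \<and>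
        (\<forall>c. (\<forall>i<r. c i \<in> R) \<and> (\<Sum>i<r. act s (c i) (h i)) = 0 \<longrightarrow> (\<forall>i<r. c i = 0))))"

text \<open>
  A toric vector bundle with \<open>r\<close>-dimensional fiber \<open>E\<close> at the base point of the open orbit, on the scheme
  glued from the spectra of the rings \<open>R \<sigma>\<close>, \<open>\<sigma> \<in> \<Omega>\<close>. It is given by the modules \<open>H \<sigma>\<close> of sections over the
  affine charts, regarded inside the sections over the open orbit (the chart of the cone \<open>0\<close>), and
  these are identified with \<open>K[M] \<otimes> E\<close> by \<open>s \<mapsto> (t \<mapsto> t\<^sup>-\<^sup>1 s(t x\<^sub>0))\<close>. Under this identification the
  torus acts through the \<open>M\<close>-grading, so that \<open>T\<close>-linearized means \<open>M\<close>-graded. The chart of a face \<open>\<tau>\<close> of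
  \<open>\<sigma>\<close> is an open subset of the chart of \<open>\<sigma>\<close>, and restricting sections means extending scalars
  from \<open>R \<sigma>\<close> to \<open>R \<tau>\<close>. The same notion is used over \<open>\<O>\<close> and over a field, with different \<open>R\<close>.
\<close>

definition toric_vector_bundle ::
  "('k::field \<Rightarrow> 'e::ab_group_add \<Rightarrow> 'e) \<Rightarrow> nat \<Rightarrow> 'w::real_vector set set \<Rightarrow>
   ('w set \<Rightarrow> ('m::ab_group_add \<Rightarrow>\<^sub>0 'k) set) \<Rightarrow> ('w set \<Rightarrow> ('m \<Rightarrow>\<^sub>0 'e) set) \<Rightarrow> bool" where
  "toric_vector_bundle s r \<Omega> R H \<longleftrightarrow>
     (\<exists>b. is_basis s r b) \<and>
     (\<forall>\<sigma>\<in>\<Omega>. submodule s (R \<sigma>) (H \<sigma>)) \<and>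
     (\<forall>\<sigma>\<in>\<Omega>. \<forall>h\<in>H \<sigma>. \<forall>u. Poly_Mapping.single u (Poly_Mapping.lookup h u) \<in> H \<sigma>) \<and>
     (\<forall>\<sigma>\<in>\<Omega>. locally_free s r (R \<sigma>) (H \<sigma>)) \<and>
     (\<forall>\<sigma>\<in>\<Omega>. \<forall>\<tau>\<in>\<Omega>. \<tau> face_of \<sigma> \<longrightarrow> H \<tau> = combinations s (R \<tau>) (H \<sigma>)) \<and>
     H {0} = UNIV"

text \<open>\<open>H = \<Oplus>\<^sub>i R \<chi>\<^bsup>-u\<^sub>i\<^esup> b\<^sub>i\<close>; the sum is direct because \<open>b\<close> is a basis.\<close>

definition splitting ::
  "('k::field \<Rightarrow> 'e::ab_group_add \<Rightarrow> 'e) \<Rightarrow> nat \<Rightarrow> ('m::ab_group_add \<Rightarrow>\<^sub>0 'k) set \<Rightarrow> ('m \<Rightarrow>\<^sub>0 'e) set \<Rightarrow>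
   (nat \<Rightarrow> 'e) \<Rightarrow> (nat \<Rightarrow> 'm) \<Rightarrow> bool" where
  "splitting s r R H b u \<longleftrightarrow> is_basis s r b \<and>
     H = {\<Sum>i<r. act s (f i) (Poly_Mapping.single (- u i) (b i)) | f. \<forall>i<r. f i \<in> R}"

text \<open>\<open>\<Phi>\<close> is the graded piecewise linear map \<open>\<Phi>\<^sub>\<E>\<close> of a toric vector bundle over \<open>\<O>\<close>.\<close>

definition graded_map_of_bundle ::
  "('m::ab_group_add \<Rightarrow> 'v::real_vector \<Rightarrow> real) \<Rightarrow> ('k::field \<Rightarrow> int) \<Rightarrow> 'k \<Rightarrow>
   ('k \<Rightarrow> 'e::ab_group_add \<Rightarrow> 'e) \<Rightarrow> nat \<Rightarrow> ('v \<times> real) set set \<Rightarrow>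
   (('v \<times> real) set \<Rightarrow> ('m \<Rightarrow>\<^sub>0 'e) set) \<Rightarrow> ('v \<times> real \<Rightarrow> 'e \<Rightarrow> ereal) \<Rightarrow> bool" where
  "graded_map_of_bundle pr val \<pi> s r \<Sigma> H \<Phi> \<longleftrightarrow>
     (\<forall>\<sigma>\<in>\<Sigma>. \<exists>b u. splitting s r (chart_ring pr val \<pi> \<sigma>) (H \<sigma>) b u \<and>
        (\<forall>(x, m)\<in>\<sigma>. \<Phi> (x, m) \<in> apartment val s m r b \<and> (\<forall>i<r. \<Phi> (x, m) (b i) = ereal (pr (u i) x))))"

text \<open>\<open>\<Psi>\<close> is the piecewise linear map of a toric vector bundle on a toric variety over a field.\<close>

definition map_of_bundle ::
  "('m::ab_group_add \<Rightarrow> 'v::real_vector \<Rightarrow> real) \<Rightarrow> ('f::field \<Rightarrow> 'g::ab_group_add \<Rightarrow> 'g) \<Rightarrow> nat \<Rightarrow>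
   'v set set \<Rightarrow> ('v set \<Rightarrow> ('m \<Rightarrow>\<^sub>0 'g) set) \<Rightarrow> ('v \<Rightarrow> 'g \<Rightarrow> ereal) \<Rightarrow> bool" where
  "map_of_bundle pr s r \<Omega> H \<Psi> \<longleftrightarrow>
     (\<forall>\<sigma>\<in>\<Omega>. \<exists>b u. splitting s r (chart_ring_field pr \<sigma>) (H \<sigma>) b u \<and>
        (\<forall>x\<in>\<sigma>. \<Psi> x \<in> apartment_sph s r b \<and> (\<forall>i<r. \<Psi> x (b i) = ereal (pr (u i) x))))"


section \<open>Restriction to a component of the special fiber\<close>

text \<open>
  The surjection \<open>R\<^sub>\<Delta> \<rightarrow> \<kk>[\<chi>\<^sup>u : (u, -\<langle>u,\<nu>\<rangle>) \<in> cone(\<Delta>)\<^sup>\<or>] = \<kk>[\<Delta>\<^sub>\<nu>\<^sup>\<or> \<inter> M]\<close> defining the component of \<open>\<nu>\<close>: it sends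
  \<open>\<chi>\<^sup>u\<pi>\<^sup>k\<close> to the class of \<open>\<pi>\<^bsup>k + \<langle>u,\<nu>\<rangle>\<^esup>\<close> times \<open>\<chi>\<^sup>u\<close>, that is, to \<open>\<chi>\<^sup>u\<close> if \<open>k = -\<langle>u,\<nu>\<rangle>\<close> and to \<open>0\<close> if
  \<open>k > -\<langle>u,\<nu>\<rangle>\<close>. Here \<open>\<langle>u,\<nu>\<rangle>\<close> is an integer, so that the floor has no effect.
\<close>

definition restrict_function ::
  "('m::ab_group_add \<Rightarrow> 'v \<Rightarrow> real) \<Rightarrow> 'k::field \<Rightarrow> ('k \<Rightarrow> 'f::field) \<Rightarrow> 'v \<Rightarrow> ('m \<Rightarrow>\<^sub>0 'k) \<Rightarrow> ('m \<Rightarrow>\<^sub>0 'f)" where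
  "restrict_function pr \<pi> res \<nu> f = (\<Sum>u\<in>Poly_Mapping.keys f.
     Poly_Mapping.single u (res (\<pi> powi \<lfloor>pr u \<nu>\<rfloor> * Poly_Mapping.lookup f u)))"

text \<open>
  The restriction of a section over \<open>\<U>\<^sub>\<Delta>\<close> to the open orbit of the component. A section \<open>\<chi>\<^sup>ue\<close> is
  \<open>\<chi>\<^sup>u\<pi>\<^bsup>-\<langle>u,\<nu>\<rangle>\<^esup>\<lambda>\<close> with \<open>\<lambda> = \<pi>\<^bsup>\<langle>u,\<nu>\<rangle>\<^esup>e \<in> \<Lambda>\<close>; its value at \<open>x\<^sub>\<nu>\<close> is the class of \<open>\<lambda>\<close> in \<open>E\<^sub>\<Lambda>\<close>, and
  \<open>t \<mapsto> t\<^sup>-\<^sup>1 s(t x\<^sub>\<nu>)\<close> is \<open>\<chi>\<^sup>u\<close> times this value.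
\<close>

definition restrict_section ::
  "('m::ab_group_add \<Rightarrow> 'v \<Rightarrow> real) \<Rightarrow> 'k::field \<Rightarrow> ('k \<Rightarrow> 'e::ab_group_add \<Rightarrow> 'e) \<Rightarrow> ('e \<Rightarrow> 'g::ab_group_add) \<Rightarrow>
   'v \<Rightarrow> ('m \<Rightarrow>\<^sub>0 'e) \<Rightarrow> ('m \<Rightarrow>\<^sub>0 'g)" where
  "restrict_section pr \<pi> s q \<nu> h = (\<Sum>u\<in>Poly_Mapping.keys h.
     Poly_Mapping.single u (q (s (\<pi> powi \<lfloor>pr u \<nu>\<rfloor>) (Poly_Mapping.lookup h u))))"

text \<open>The sections of the restricted bundle over the chart of the cone \<open>\<sigma> = \<Delta>\<^sub>\<nu>\<close> of the star\<close>

definition restrict_bundle ::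
  "('m::ab_group_add \<Rightarrow> 'v::real_vector \<Rightarrow> real) \<Rightarrow> 'k::field \<Rightarrow> ('k \<Rightarrow> 'e::ab_group_add \<Rightarrow> 'e) \<Rightarrow>
   ('e \<Rightarrow> 'g::ab_group_add) \<Rightarrow> ('v \<times> real) set set \<Rightarrow> 'v \<Rightarrow> (('v \<times> real) set \<Rightarrow> ('m \<Rightarrow>\<^sub>0 'e) set) \<Rightarrow>
   'v set \<Rightarrow> ('m \<Rightarrow>\<^sub>0 'g) set" where
  "restrict_bundle pr \<pi> s q \<Sigma> \<nu> H \<sigma> = restrict_section pr \<pi> s q \<nu> `
     H (cone_over \<Sigma> (THE \<Delta>. \<Delta> \<in> Sigma1 \<Sigma> \<and> \<nu> \<in> \<Delta> \<and> star_cone \<nu> \<Delta> = \<sigma>))"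

text \<open>
  \<open>\<rho>\<close> exhibits the \<open>S\<close>-module \<open>H'\<close> as \<open>H \<otimes>\<^sub>R S\<close>, where \<open>\<psi> : R \<rightarrow> S\<close> is a surjective ring homomorphism: it is
  surjective, \<open>\<psi>\<close>-semilinear, and has kernel \<open>ker(\<psi>) H\<close>.
\<close>

definition base_change ::
  "('k::field \<Rightarrow> 'e::ab_group_add \<Rightarrow> 'e) \<Rightarrow> ('f::field \<Rightarrow> 'g::ab_group_add \<Rightarrow> 'g) \<Rightarrow>
   ('m::ab_group_add \<Rightarrow>\<^sub>0 'k) set \<Rightarrow> ('m \<Rightarrow>\<^sub>0 'f) set \<Rightarrow> (('m \<Rightarrow>\<^sub>0 'k) \<Rightarrow> ('m \<Rightarrow>\<^sub>0 'f)) \<Rightarrow>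
   ('m \<Rightarrow>\<^sub>0 'e) set \<Rightarrow> ('m \<Rightarrow>\<^sub>0 'g) set \<Rightarrow> (('m \<Rightarrow>\<^sub>0 'e) \<Rightarrow> ('m \<Rightarrow>\<^sub>0 'g)) \<Rightarrow> bool" where
  "base_change s sg R S \<psi> H H' \<rho> \<longleftrightarrow>
     (\<forall>f\<in>R. \<forall>g\<in>R. \<psi> (f + g) = \<psi> f + \<psi> g \<and> \<psi> (f * g) = \<psi> f * \<psi> g) \<and> \<psi> 1 = 1 \<and> \<psi> ` R = S \<and>
     (\<forall>h\<in>H. \<forall>h'\<in>H. \<rho> (h + h') = \<rho> h + \<rho> h') \<and>
     (\<forall>f\<in>R. \<forall>h\<in>H. \<rho> (act s f h) = act sg (\<psi> f) (\<rho> h)) \<and> \<rho> ` H = H' \<and>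
     {h \<in> H. \<rho> h = 0} = combinations s {f \<in> R. \<psi> f = 0} H"

end

theory Submission
  imports Defs
begin

text \<open>
  Everything takes place on one affine chart at a time. Let \<open>\<Delta>\<close> be a polyhedron containing \<open>\<nu>\<close> and \<open>\<sigma>\<close> the cone
  over it. The bundle splits over the chart: its sections are \<open>\<Oplus>\<^sub>i R\<^sub>\<sigma> \<chi>\<^bsup>-u\<^sub>i\<^esup>b\<^sub>i\<close>, and \<open>\<Phi>\<^sub>1(x)\<close> is
  adapted to \<open>b\<close> with values \<open>\<langle>u\<^sub>i,x\<rangle>\<close>. As \<open>\<langle>u\<^sub>i,\<nu>\<rangle>\<close> is an integer, the vectors
  \<open>\<lambda>\<^sub>i = \<pi>\<^bsup>-\<langle>u\<^sub>i,\<nu>\<rangle>\<^esup>b\<^sub>i\<close> form an \<open>\<O>\<close>-basis of \<open>\<Lambda> = \<Phi>\<^sub>1(\<nu>)\<close> (lemma \<open>lattice_basis_of_splitting\<close>), and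
  their classes form a basis of \<open>E\<^sub>\<Lambda>\<close> (\<open>is_basis_reduction\<close>). Both sides of the theorem are now computed
  in this basis.

  On the one hand, \<open>\<Phi>\<^sub>1(\<nu> + \<epsilon>v)\<close> is adapted to \<open>\<lambda>\<close> with values \<open>\<langle>u\<^sub>i, \<nu> + \<epsilon>v\<rangle> - \<langle>u\<^sub>i,\<nu>\<rangle> = \<epsilon>\<langle>u\<^sub>i,v\<rangle>\<close>, so that
  \<open>\<Phi>\<^sub>\<nu>(v)\<close> is adapted to the classes of the \<open>\<lambda>\<^sub>i\<close> with values \<open>\<langle>u\<^sub>i,v\<rangle>\<close> (\<open>link_map_on_star\<close>). The
  identification with the link is well defined because the reduced norm of a class is the maximum over its
  lifts (\<open>link_identified_lift\<close>). On the other hand, restriction to the component multiplies the coefficient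
  of \<open>\<chi>\<^sup>u\<close> by \<open>\<pi>\<^bsup>\<langle>u,\<nu>\<rangle>\<^esup>\<close> and reduces. It maps \<open>\<chi>\<^bsup>-u\<^sub>i\<^esup>b\<^sub>i\<close> to \<open>\<chi>\<^bsup>-u\<^sub>i\<^esup>\<close> times the class of \<open>\<lambda>\<^sub>i\<close>, it
  is semilinear over the surjection from \<open>R\<^sub>\<sigma>\<close> to the coordinate ring of the chart of \<open>\<Delta>\<^sub>\<nu>\<close>, and therefore the
  restricted bundle splits with the same characters \<open>u\<^sub>i\<close> and these classes (\<open>splitting_restriction\<close>). The
  data agree, so \<open>\<Phi>\<^sub>\<nu>\<close> is the map of the restricted bundle.

  The combinatorics rests on one observation: \<open>\<Delta>\<^sub>\<nu>\<close> is the image of \<open>\<sigma>\<close> under the projection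
  \<open>(x, t) \<mapsto> x - t\<nu>\<close>, and the projection is a bijection, compatible with faces and intersections, from the cones of
  \<open>\<Sigma>\<close> that contain \<open>(\<nu>, 1)\<close> to the cones of the star, because faces containing the ray of \<open>\<nu>\<close> are saturated
  (\<open>link_proj_mem_image_iff\<close>). This yields the fan axioms for the star and transports the gluing of charts
  along faces.
\<close>

section \<open>Faces of convex cones\<close>

text \<open>
  For convex cones the condition on open segments amounts to an additive one, which is preserved by
  linear maps and therefore suits the projection along a ray.
\<close>

lemma face_of_convex_cone_iff:
  assumes C: "convex_cone C"
  shows "F face_of C \<and> F \<noteq> {} \<longleftrightarrow>
    F \<subseteq> C \<and> convex_cone F \<and> (\<forall>x\<in>C. \<forall>y\<in>C. x + y \<in> F \<longrightarrow> x \<in> F)"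
proof (intro iffI conjI; (elim conjE)?)
  assume face: "F face_of C" and ne: "F \<noteq> {}"
  show "F \<subseteq> C"
    using face by (simp add: face_of_def)
  have convex: "convex F"
    using face by (simp add: face_of_def)
  have scale: "c *\<^sub>R x \<in> F" if x: "x \<in> F" and c: "0 \<le> c" for c x
  proof (cases "x = 0")
    case False
    \<comment> \<open>Any \<open>d > max 1 c\<close> serves: \<open>x\<close> is then strictly between \<open>0\<close> and \<open>d x\<close>, so that these
      lie in \<open>F\<close>, and \<open>c x\<close> is between them.\<close>
    define d where "d = c + 2"
    have d: "1 < d" "0 \<le> c / d" "c / d \<le> 1"
      using c by (auto simp: d_def)
    then have cd: "(c / d) *\<^sub>R d *\<^sub>R x = c *\<^sub>R x"
      by simp
    have "x \<in> open_segment 0 (d *\<^sub>R x)"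
      unfolding in_segment using False d by (auto intro!: exI[of _ "1 / d"])
    moreover have "0 \<in> C" "d *\<^sub>R x \<in> C"
      using C x \<open>F \<subseteq> C\<close> d by (auto simp: convex_cone_contains_0 convex_cone_scaleR)
    ultimately have "0 \<in> F" "d *\<^sub>R x \<in> F"
      using face x by (blast dest: face_ofD)+
    then have "(1 - c / d) *\<^sub>R 0 + (c / d) *\<^sub>R d *\<^sub>R x \<in> F"
      using d by (intro convexD[OF convex]) auto
    then show ?thesis
      by (simp only: cd) simp
  qed (use x in simp)
  show "convex_cone F"
    using convex ne scale by (auto simp: convex_cone_def conic_def)
  show "\<forall>x\<in>C. \<forall>y\<in>C. x + y \<in> F \<longrightarrow> x \<in> F"
  proof (intro ballI impI)
    fix x y assume xy: "x \<in> C" "y \<in> C" "x + y \<in> F"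
    have "2 *\<^sub>R x \<in> F"
    proof (cases "x = y")
      case True
      with xy(3) show ?thesis by (simp add: scaleR_2)
    next
      case False
      \<comment> \<open>\<open>x + y\<close> is the midpoint of \<open>2x\<close> and \<open>2y\<close>.\<close>
      have "x + y \<in> open_segment (2 *\<^sub>R x) (2 *\<^sub>R y)"
        unfolding in_segment using False by (auto intro!: exI[of _ "1 / 2"])
      moreover have "2 *\<^sub>R x \<in> C" "2 *\<^sub>R y \<in> C"
        using C xy by (auto simp: convex_cone_scaleR)
      ultimately show ?thesis
        using face xy(3) by (blast dest: face_ofD)
    qed
    from scale[OF this, of "1 / 2"] show "x \<in> F" by simp
  qed
next
  assume sub: "F \<subseteq> C" and F: "convex_cone F" and sum: "\<forall>x\<in>C. \<forall>y\<in>C. x + y \<in> F \<longrightarrow> x \<in> F"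
  show "F \<noteq> {}"
    using F by (rule convex_cone_nonempty)
  have cancel: "x \<in> F" if "x \<in> C" "y \<in> C" "0 < c" "0 \<le> d" "c *\<^sub>R x + d *\<^sub>R y \<in> F" for x y c d
  proof -
    have "c *\<^sub>R x \<in> C" "d *\<^sub>R y \<in> C"
      using that C by (auto simp: convex_cone_scaleR)
    with sum that(5) have "c *\<^sub>R x \<in> F"
      by blast
    with that convex_cone_scaleR[OF F, of "inverse c"] show ?thesis by force
  qed
  show "F face_of C"
    unfolding face_of_def
  proof (intro conjI ballI impI sub)
    show "convex F"
      using F by (simp add: convex_cone_def)
  next
    fix a b x assume ab: "a \<in> C" "b \<in> C" and x: "x \<in> F" "x \<in> open_segment a b"
    then obtain t where t: "0 < t" "t < 1" "x = (1 - t) *\<^sub>R a + t *\<^sub>R b"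
      unfolding in_segment by auto
    show "a \<in> F"
      using cancel[of a b "1 - t" t] ab x t by auto
    show "b \<in> F"
      using cancel[of b a t "1 - t"] ab x t by (auto simp: add.commute)
  qed
qed

section \<open>The star of a vertex as a projection\<close>

text \<open>
  The projection of \<open>N\<^sub>\<real> \<times> \<real>\<close> to \<open>N\<^sub>\<real>\<close> along the line through \<open>(\<nu>, 1)\<close>. Its transpose is
  \<open>u \<mapsto> (u, -\<langle>u,\<nu>\<rangle>)\<close>, so that the dual of the projection of a cone \<open>\<sigma>\<close> is
  \<open>{u. (u, -\<langle>u,\<nu>\<rangle>) \<in> \<sigma>\<^sup>\<or>}\<close>: these are the characters that are regular on the chart of the component.
\<close>

definition link_proj :: "'v::real_vector \<Rightarrow> 'v \<times> real \<Rightarrow> 'v" where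
  "link_proj \<nu> p = fst p - snd p *\<^sub>R \<nu>"

lemma link_proj_Pair [simp]: "link_proj \<nu> (x, t) = x - t *\<^sub>R \<nu>"
  by (simp add: link_proj_def)

lemma linear_link_proj: "linear (link_proj \<nu>)"
  by (rule linearI) (auto simp: link_proj_def algebra_simps)

lemma convex_cone_link_proj: "convex_cone \<sigma> \<Longrightarrow> convex_cone (link_proj \<nu> ` \<sigma>)"
  by (simp add: convex_cone_linear_image linear_link_proj)

lemma link_proj_eqD:
  assumes "link_proj \<nu> p = link_proj \<nu> p'"
  shows "\<exists>c. p = p' + c *\<^sub>R (\<nu>, 1)"
  using assms
  by (intro exI[of _ "snd p - snd p'"], cases p; cases p') (auto simp: algebra_simps)

text \<open>
  The cone over \<open>\<Delta>\<close> consists of the multiples of \<open>\<Delta> \<times> {1}\<close> and of recession directions. The latter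
  are also projected into the star cone, because \<open>\<nu>\<close> plus a recession direction lies in \<open>\<Delta>\<close>.
\<close>

lemma star_cone_slice:
  assumes \<sigma>: "convex_cone \<sigma>" and t: "\<forall>(x, t)\<in>\<sigma>. 0 \<le> t" and \<nu>: "(\<nu>, 1) \<in> \<sigma>"
  shows "star_cone \<nu> (slice 1 \<sigma>) = link_proj \<nu> ` \<sigma>"
proof (intro equalityI subsetI)
  fix v assume "v \<in> star_cone \<nu> (slice 1 \<sigma>)"
  then obtain t x where v: "v = t *\<^sub>R (x - \<nu>)" "0 \<le> t" "(x, 1) \<in> \<sigma>"
    by (auto simp: star_cone_def slice_def)
  show "v \<in> link_proj \<nu> ` \<sigma>"
    using v convex_cone_scaleR[OF \<sigma> v(2,3)]
    by (intro image_eqI[of _ _ "t *\<^sub>R (x, 1)"]) (auto simp: algebra_simps)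
next
  fix v assume "v \<in> link_proj \<nu> ` \<sigma>"
  then obtain x t where v: "v = x - t *\<^sub>R \<nu>" "(x, t) \<in> \<sigma>"
    by auto
  with t have "0 \<le> t" by auto
  \<comment> \<open>Adding \<open>(\<nu>, 1)\<close> does not change the projection and makes the height positive, so that
    one can rescale to height \<open>1\<close> even if \<open>t = 0\<close>.\<close>
  define y where "y = inverse (t + 1) *\<^sub>R (x + \<nu>)"
  have "inverse (t + 1) *\<^sub>R ((x, t) + (\<nu>, 1)) \<in> \<sigma>"
    using \<open>0 \<le> t\<close> by (intro convex_cone_scaleR[OF \<sigma>] convex_cone_add[OF \<sigma>] v \<nu>) simp
  then have "(y, 1) \<in> \<sigma>"
    using \<open>0 \<le> t\<close> by (simp add: y_def)
  moreover have "(t + 1) *\<^sub>R y = x + \<nu>"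
    using \<open>0 \<le> t\<close> by (simp add: y_def)
  then have "v = (t + 1) *\<^sub>R (y - \<nu>)"
    by (simp add: v algebra_simps)
  ultimately show "v \<in> star_cone \<nu> (slice 1 \<sigma>)"
    using \<open>0 \<le> t\<close> by (auto simp: star_cone_def slice_def intro!: exI[of _ "t + 1"] exI[of _ y])
qed

text \<open>
  Faces that contain the ray of \<open>\<nu>\<close> are saturated for the projection. This is what makes the projection
  faithful on the part of the fan around \<open>\<nu>\<close>.
\<close>

lemma link_proj_mem_image_iff:
  assumes \<sigma>: "convex_cone \<sigma>" and F: "F face_of \<sigma>" and \<nu>: "(\<nu>, 1) \<in> F" and p: "p \<in> \<sigma>"
  shows "link_proj \<nu> p \<in> link_proj \<nu> ` F \<longleftrightarrow> p \<in> F"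
proof
  assume "link_proj \<nu> p \<in> link_proj \<nu> ` F"
  then obtain f c where f: "f \<in> F" "p = f + c *\<^sub>R (\<nu>, 1)"
    by (metis imageE link_proj_eqD)
  have face: "F \<subseteq> \<sigma>" "convex_cone F" "\<forall>x\<in>\<sigma>. \<forall>y\<in>\<sigma>. x + y \<in> F \<longrightarrow> x \<in> F"
    using face_of_convex_cone_iff[OF \<sigma>, of F] F \<nu> by auto
  \<comment> \<open>The parts of \<open>c\<close> of either sign are moved to different sides, since only nonnegative
    multiples of \<open>(\<nu>, 1)\<close> belong to the cones.\<close>
  have "p + max 0 (- c) *\<^sub>R (\<nu>, 1) = f + max 0 c *\<^sub>R (\<nu>, 1)"
    by (simp add: f max_def)
  also have "\<dots> \<in> F"
    using f \<nu> by (intro convex_cone_add[OF face(2)] convex_cone_scaleR[OF face(2)]) auto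
  finally have "p + max 0 (- c) *\<^sub>R (\<nu>, 1) \<in> F" .
  moreover have "max 0 (- c) *\<^sub>R (\<nu>, 1) \<in> \<sigma>"
    using face \<nu> by (intro convex_cone_scaleR[OF \<sigma>]) auto
  ultimately show "p \<in> F"
    using face(3) p by blast
qed simp

locale fan_with_vertex =
  fixes L :: "('v::real_vector \<times> real) set" and \<Sigma> :: "('v \<times> real) set set" and \<nu> :: 'v
  assumes fan: "fan L \<Sigma>" and height: "\<forall>\<sigma>\<in>\<Sigma>. \<forall>(x, t)\<in>\<sigma>. 0 \<le> t" and vertex: "{\<nu>} \<in> Sigma1 \<Sigma>"
begin

definition star_cones :: "('v \<times> real) set set" where
  "star_cones = {\<sigma>\<in>\<Sigma>. (\<nu>, 1) \<in> \<sigma>}"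

definition vertex_ray :: "('v \<times> real) set" where
  "vertex_ray = (\<lambda>c. c *\<^sub>R (\<nu>, 1)) ` {0..}"

lemma rational_cone: "\<sigma> \<in> \<Sigma> \<Longrightarrow> rational_cone L \<sigma>"
  using fan by (simp add: fan_def)

lemma convex_cone: "\<sigma> \<in> \<Sigma> \<Longrightarrow> convex_cone \<sigma>"
  using rational_cone[of \<sigma>] by (auto simp: rational_cone_def convex_cone_convex_cone_hull)

lemma fan_inter_face: "\<sigma> \<in> \<Sigma> \<Longrightarrow> \<tau> \<in> \<Sigma> \<Longrightarrow> \<sigma> \<inter> \<tau> face_of \<sigma>"
  using fan by (auto simp: fan_def)

lemma fan_face: "\<sigma> \<in> \<Sigma> \<Longrightarrow> F face_of \<sigma> \<Longrightarrow> F \<noteq> {} \<Longrightarrow> F \<in> \<Sigma>"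
  using fan by (simp add: fan_def)

lemma face_memD:
  assumes "\<sigma> \<in> \<Sigma>" "F face_of \<sigma>" "x \<in> \<sigma>" "y \<in> \<sigma>" "x + y \<in> F"
  shows "x \<in> F"
  using face_of_convex_cone_iff[OF convex_cone[OF assms(1)], of F] assms by blast

lemma star_cones_face:
  "\<sigma> \<in> star_cones \<Longrightarrow> F face_of \<sigma> \<Longrightarrow> (\<nu>, 1) \<in> F \<Longrightarrow> F \<in> star_cones"
  using fan_face by (auto simp: star_cones_def)

text \<open>
  A cone of the fan is determined by its nonempty slice at height \<open>1\<close>: a point \<open>p\<close> of height \<open>0\<close> is recovered
  by adding a point of the slice, because the sum lies in a common face. Hence polyhedra of \<open>\<Sigma>\<^sub>1\<close> can be
  replaced by cones of \<open>\<Sigma>\<close> throughout.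
\<close>

lemma cone_subset_if_slice_subset:
  assumes "\<sigma> \<in> \<Sigma>" "\<tau> \<in> \<Sigma>" "slice 1 \<sigma> \<subseteq> slice 1 \<tau>" "slice 1 \<sigma> \<noteq> {}"
  shows "\<sigma> \<subseteq> \<tau>"
proof
  fix p assume p: "p \<in> \<sigma>"
  obtain x t where xt: "p = (x, t)" by (cases p)
  with height assms p have t: "0 \<le> t" by auto
  obtain y where y: "(y, 1) \<in> \<sigma>"
    using assms(4) by (auto simp: slice_def)
  note \<sigma> = convex_cone[OF assms(1)] and \<tau> = convex_cone[OF assms(2)]
  have "inverse (t + 1) *\<^sub>R (p + (y, 1)) \<in> \<sigma>"
    using t by (intro convex_cone_scaleR[OF \<sigma>] convex_cone_add[OF \<sigma>] p y) simp
  then have "inverse (t + 1) *\<^sub>R (x + y) \<in> slice 1 \<tau>"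
    using assms(3) t by (auto simp: slice_def xt)
  then have "(t + 1) *\<^sub>R (inverse (t + 1) *\<^sub>R (x + y), 1) \<in> \<tau>"
    using t by (intro convex_cone_scaleR[OF \<tau>]) (auto simp: slice_def)
  then have "p + (y, 1) \<in> \<tau>"
    using t by (simp add: xt)
  then have "p + (y, 1) \<in> \<sigma> \<inter> \<tau>"
    using convex_cone_add[OF \<sigma> p y] by simp
  then show "p \<in> \<tau>"
    using face_memD[OF assms(1) fan_inter_face[OF assms(1,2)] p y] by simp
qed

lemma cone_over_slice:
  assumes "\<sigma> \<in> \<Sigma>" "slice 1 \<sigma> \<noteq> {}"
  shows "cone_over \<Sigma> (slice 1 \<sigma>) = \<sigma>"
  unfolding cone_over_def
proof (rule the_equality)
  fix \<tau> assume "\<tau> \<in> \<Sigma> \<and> slice 1 \<tau> = slice 1 \<sigma>"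
  then show "\<tau> = \<sigma>"
    using cone_subset_if_slice_subset[of \<sigma> \<tau>] cone_subset_if_slice_subset[of \<tau> \<sigma>] assms by auto
qed (use assms in auto)

lemma cone_over_slice_star: "\<sigma> \<in> star_cones \<Longrightarrow> cone_over \<Sigma> (slice 1 \<sigma>) = \<sigma>"
  by (rule cone_over_slice) (auto simp: star_cones_def slice_def)

lemma polyhedra_at_vertex: "{\<Delta> \<in> Sigma1 \<Sigma>. \<nu> \<in> \<Delta>} = slice 1 ` star_cones"
  by (auto simp: Sigma1_def star_cones_def slice_def)

lemma star_cone_slice_star: "\<sigma> \<in> star_cones \<Longrightarrow> star_cone \<nu> (slice 1 \<sigma>) = link_proj \<nu> ` \<sigma>"
  using height by (intro star_cone_slice convex_cone) (auto simp: star_cones_def)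

lemma star_eq: "star \<Sigma> \<nu> = (`) (link_proj \<nu>) ` star_cones"
  by (auto simp: star_def polyhedra_at_vertex star_cone_slice_star image_image)

lemma vertex_ray_star: "vertex_ray \<in> star_cones"
proof -
  obtain \<rho> where \<rho>: "\<rho> \<in> \<Sigma>" "slice 1 \<rho> = {\<nu>}"
    using vertex by (auto simp: Sigma1_def)
  note cone = convex_cone[OF \<rho>(1)]
  have \<nu>: "(\<nu>, 1) \<in> \<rho>"
    using \<rho>(2) by (auto simp: slice_def)
  have "link_proj \<nu> ` \<rho> = star_cone \<nu> {\<nu>}"
    using star_cone_slice[OF cone _ \<nu>] height \<rho> by simp
  then have "link_proj \<nu> p = 0" if "p \<in> \<rho>" for p
    using that by (auto simp: star_cone_def)
  then have "p = snd p *\<^sub>R (\<nu>, 1)" if "p \<in> \<rho>" for p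
    using that by (cases p) auto
  moreover have "0 \<le> snd p" if "p \<in> \<rho>" for p
    using height \<rho>(1) that by (cases p) auto
  ultimately have "\<rho> = vertex_ray"
    using convex_cone_scaleR[OF cone _ \<nu>] by (fastforce simp: vertex_ray_def)
  with \<rho> \<nu> show ?thesis by (simp add: star_cones_def)
qed

lemma link_proj_vertex_ray: "link_proj \<nu> ` vertex_ray = {0}"
  by (simp add: vertex_ray_def image_image image_constant_conv)

text \<open>
  The projections of two points agree only if these differ by a multiple of \<open>(\<nu>, 1)\<close>, and adding a large
  multiple of \<open>(\<nu>, 1)\<close> leads to a common point of both cones.
\<close>

lemma link_proj_inter:
  assumes \<sigma>: "\<sigma> \<in> star_cones" and \<tau>: "\<tau> \<in> star_cones"
  shows "link_proj \<nu> ` \<sigma> \<inter> link_proj \<nu> ` \<tau> = link_proj \<nu> ` (\<sigma> \<inter> \<tau>)"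
proof (intro equalityI subsetI)
  fix v assume "v \<in> link_proj \<nu> ` \<sigma> \<inter> link_proj \<nu> ` \<tau>"
  then obtain p p' where p: "p \<in> \<sigma>" "p' \<in> \<tau>" "v = link_proj \<nu> p" "link_proj \<nu> p = link_proj \<nu> p'"
    by auto
  then obtain c where c: "p = p' + c *\<^sub>R (\<nu>, 1)"
    using link_proj_eqD by blast
  have cones: "convex_cone \<sigma>" "convex_cone \<tau>" "(\<nu>, 1) \<in> \<sigma>" "(\<nu>, 1) \<in> \<tau>"
    using \<sigma> \<tau> by (auto simp: star_cones_def convex_cone)
  define z where "z = p + max 0 (- c) *\<^sub>R (\<nu>, 1)"
  have "z = p' + max 0 c *\<^sub>R (\<nu>, 1)"
    by (simp add: z_def c max_def)
  then have "z \<in> \<tau>"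
    using p cones by (simp del: scaleR_Pair) (intro convex_cone_add convex_cone_scaleR; simp)
  moreover have "z \<in> \<sigma>"
    using p cones unfolding z_def by (intro convex_cone_add convex_cone_scaleR) auto
  ultimately have "z \<in> \<sigma> \<inter> \<tau>" by blast
  moreover have "link_proj \<nu> z = v"
    using p(3) by (cases p) (simp add: z_def algebra_simps)
  ultimately show "v \<in> link_proj \<nu> ` (\<sigma> \<inter> \<tau>)"
    by blast
qed auto

lemma link_proj_subsetD:
  assumes \<sigma>: "\<sigma> \<in> star_cones" and \<tau>: "\<tau> \<in> star_cones"
    and sub: "link_proj \<nu> ` \<sigma> \<subseteq> link_proj \<nu> ` \<tau>"
  shows "\<sigma> \<subseteq> \<tau>"
proof
  fix p assume p: "p \<in> \<sigma>"
  then have "link_proj \<nu> p \<in> link_proj \<nu> ` (\<sigma> \<inter> \<tau>)"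
    using sub by (subst link_proj_inter[OF \<sigma> \<tau>, symmetric]) auto
  then show "p \<in> \<tau>"
    using link_proj_mem_image_iff[OF convex_cone fan_inter_face _ p] \<sigma> \<tau>
    by (auto simp: star_cones_def)
qed

lemma face_of_link_proj_image:
  assumes \<sigma>: "\<sigma> \<in> star_cones" and F: "F face_of \<sigma>" and \<nu>: "(\<nu>, 1) \<in> F"
  shows "link_proj \<nu> ` F face_of link_proj \<nu> ` \<sigma>"
proof -
  have cone: "convex_cone \<sigma>" and \<sigma>': "\<sigma> \<in> \<Sigma>"
    using \<sigma> by (auto simp: star_cones_def convex_cone)
  have face: "F \<subseteq> \<sigma>" "convex_cone F"
    using face_of_convex_cone_iff[OF cone, of F] F \<nu> by auto
  have "x \<in> link_proj \<nu> ` F"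
    if xy: "x \<in> link_proj \<nu> ` \<sigma>" "y \<in> link_proj \<nu> ` \<sigma>" "x + y \<in> link_proj \<nu> ` F" for x y
  proof -
    obtain p p' where p: "p \<in> \<sigma>" "x = link_proj \<nu> p" "p' \<in> \<sigma>" "y = link_proj \<nu> p'"
      using xy by auto
    then have "link_proj \<nu> (p + p') \<in> link_proj \<nu> ` F"
      using xy(3) by (simp add: linear_add[OF linear_link_proj])
    then have "p + p' \<in> F"
      using link_proj_mem_image_iff[OF cone F \<nu>] convex_cone_add[OF cone] p by blast
    then show ?thesis
      using face_memD[OF \<sigma>' F] p by blast
  qed
  then have "link_proj \<nu> ` F \<subseteq> link_proj \<nu> ` \<sigma> \<and> convex_cone (link_proj \<nu> ` F) \<and>
      (\<forall>x\<in>link_proj \<nu> ` \<sigma>. \<forall>y\<in>link_proj \<nu> ` \<sigma>. x + y \<in> link_proj \<nu> ` F \<longrightarrow> x \<in> link_proj \<nu> ` F)"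
    using convex_cone_link_proj[OF face(2)] face(1) by (intro conjI ballI impI image_mono) simp_all
  then show ?thesis
    using face_of_convex_cone_iff[OF convex_cone_link_proj[OF cone, of \<nu>], of "link_proj \<nu> ` F"] by simp
qed

text \<open>
  Conversely to the preceding lemma, all faces of the projected cone arise from faces of \<open>\<sigma>\<close> around \<open>\<nu>\<close>:
  take the preimage.
\<close>

lemma face_of_star_coneE:
  assumes \<sigma>: "\<sigma> \<in> star_cones" and \<tau>: "\<tau> face_of link_proj \<nu> ` \<sigma>" "\<tau> \<noteq> {}"
  obtains F where "F face_of \<sigma>" "(\<nu>, 1) \<in> F" "link_proj \<nu> ` F = \<tau>"
proof
  have cone: "convex_cone \<sigma>" and \<nu>: "(\<nu>, 1) \<in> \<sigma>"
    using \<sigma> by (auto simp: star_cones_def convex_cone)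
  have face: "\<tau> \<subseteq> link_proj \<nu> ` \<sigma>" "convex_cone \<tau>"
      "\<forall>x\<in>link_proj \<nu> ` \<sigma>. \<forall>y\<in>link_proj \<nu> ` \<sigma>. x + y \<in> \<tau> \<longrightarrow> x \<in> \<tau>"
    using face_of_convex_cone_iff[of "link_proj \<nu> ` \<sigma>" \<tau>] \<tau>
      convex_cone_link_proj[OF cone] by auto
  define F where "F = {p \<in> \<sigma>. link_proj \<nu> p \<in> \<tau>}"
  have "convex_cone F"
    using cone face(2) \<nu> unfolding F_def convex_cone_iff
    by (auto simp: linear_add[OF linear_link_proj] linear_scale[OF linear_link_proj]
        linear_0[OF linear_link_proj])
  then show "F face_of \<sigma>"
    using face_of_convex_cone_iff[OF cone, of F] face(3)
    by (auto simp: F_def linear_add[OF linear_link_proj])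
  show "(\<nu>, 1) \<in> F"
    using \<nu> convex_cone_contains_0[OF face(2)] by (simp add: F_def)
  show "link_proj \<nu> ` F = \<tau>"
    using face(1) by (auto simp: F_def)
qed

lemma face_of_link_proj_imageD:
  assumes \<sigma>: "\<sigma> \<in> star_cones" and \<tau>: "\<tau> \<in> star_cones"
    and face: "link_proj \<nu> ` \<tau> face_of link_proj \<nu> ` \<sigma>"
  shows "\<tau> face_of \<sigma>"
proof -
  obtain F where F: "F face_of \<sigma>" "(\<nu>, 1) \<in> F" "link_proj \<nu> ` F = link_proj \<nu> ` \<tau>"
    using face_of_star_coneE[OF \<sigma> face] \<tau> by (auto simp: star_cones_def)
  have "F \<in> star_cones"
    by (rule star_cones_face[OF \<sigma> F(1,2)])
  then have "F = \<tau>"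
    using link_proj_subsetD[of F \<tau>] link_proj_subsetD[of \<tau> F] \<tau> F(3) by auto
  with F(1) show ?thesis by simp
qed

text \<open>
  The ray of \<open>\<nu>\<close> is a face of \<open>\<sigma>\<close>, so its projection, the origin, is a face of the projected cone.
\<close>

lemma strongly_convex_link_proj:
  assumes \<sigma>: "\<sigma> \<in> star_cones"
  shows "strongly_convex (link_proj \<nu> ` \<sigma>)"
  unfolding strongly_convex_def
proof (intro allI impI)
  fix v assume v: "v \<in> link_proj \<nu> ` \<sigma> \<and> - v \<in> link_proj \<nu> ` \<sigma>"
  have "link_proj \<nu> ` \<sigma> \<inter> link_proj \<nu> ` vertex_ray = {0}"
    using convex_cone_contains_0[OF convex_cone_link_proj[OF convex_cone]] \<sigma>
    by (auto simp: link_proj_vertex_ray star_cones_def)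
  then have "{0} face_of link_proj \<nu> ` \<sigma>"
    using face_of_link_proj_image[OF \<sigma> fan_inter_face[of \<sigma> vertex_ray]] \<sigma> vertex_ray_star
      link_proj_inter[OF \<sigma> vertex_ray_star] by (auto simp: star_cones_def)
  moreover have "convex_cone (link_proj \<nu> ` \<sigma>)"
    using \<sigma> by (intro convex_cone_link_proj convex_cone) (simp add: star_cones_def)
  ultimately have "\<forall>x\<in>link_proj \<nu> ` \<sigma>. \<forall>y\<in>link_proj \<nu> ` \<sigma>. x + y \<in> {0} \<longrightarrow> x \<in> {0}"
    using face_of_convex_cone_iff[of "link_proj \<nu> ` \<sigma>" "{0}"] by blast
  from this[THEN bspec, of v, THEN bspec, of "- v"] v show "v = 0"
    by simp
qed

lemma fan_star:
  assumes L: "\<And>x t. (x, t) \<in> L \<Longrightarrow> x - t *\<^sub>R \<nu> \<in> N"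
  shows "fan N (star \<Sigma> \<nu>)"
  unfolding fan_def star_eq
proof (intro conjI ballI allI impI)
  show "finite ((`) (link_proj \<nu>) ` star_cones)"
    using fan by (auto simp: fan_def star_cones_def)
  show "(`) (link_proj \<nu>) ` star_cones \<noteq> {}"
    using vertex_ray_star by auto
next
  fix \<sigma>' assume "\<sigma>' \<in> (`) (link_proj \<nu>) ` star_cones"
  then obtain \<sigma> where \<sigma>: "\<sigma> \<in> star_cones" "\<sigma>' = link_proj \<nu> ` \<sigma>" by auto
  then show "strongly_convex \<sigma>'"
    by (simp add: strongly_convex_link_proj)
  obtain G where "finite G" "G \<subseteq> L" "\<sigma> = convex_cone hull G"
    using \<sigma>(1) rational_cone[of \<sigma>] by (auto simp: star_cones_def rational_cone_def)
  then show "rational_cone N \<sigma>'"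
    unfolding rational_cone_def \<sigma>(2) using L
    by (intro exI[of _ "link_proj \<nu> ` G"])
      (auto simp: convex_cone_hull_linear_image[OF linear_link_proj])
  fix \<tau> assume \<tau>: "\<tau> face_of \<sigma>' \<and> \<tau> \<noteq> {}"
  then obtain F where "F face_of \<sigma>" "(\<nu>, 1) \<in> F" "link_proj \<nu> ` F = \<tau>"
    using face_of_star_coneE[OF \<sigma>(1)] \<sigma>(2) by blast
  then show "\<tau> \<in> (`) (link_proj \<nu>) ` star_cones"
    using star_cones_face[OF \<sigma>(1)] by blast
next
  have inter: "link_proj \<nu> ` \<sigma> \<inter> link_proj \<nu> ` \<tau> face_of link_proj \<nu> ` \<sigma>"
    if "\<sigma> \<in> star_cones" "\<tau> \<in> star_cones" for \<sigma> \<tau>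
    unfolding link_proj_inter[OF that]
    using that by (intro face_of_link_proj_image fan_inter_face) (auto simp: star_cones_def)
  fix \<sigma>' \<tau>' assume "\<sigma>' \<in> (`) (link_proj \<nu>) ` star_cones" "\<tau>' \<in> (`) (link_proj \<nu>) ` star_cones"
  then obtain \<sigma> \<tau> where "\<sigma> \<in> star_cones" "\<sigma>' = link_proj \<nu> ` \<sigma>" "\<tau> \<in> star_cones" "\<tau>' = link_proj \<nu> ` \<tau>"
    by blast
  then show "\<sigma>' \<inter> \<tau>' face_of \<sigma>'" "\<sigma>' \<inter> \<tau>' face_of \<tau>'"
    using inter[of \<sigma> \<tau>] inter[of \<tau> \<sigma>] by (simp_all add: Int_commute)
qed

end

section \<open>The action of the group algebra\<close>

lemma lookup_act:
  assumes s: "vector_space s" and A: "finite A" "Poly_Mapping.keys f \<subseteq> A"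
  shows "Poly_Mapping.lookup (act s f h) w =
    (\<Sum>u\<in>A. s (Poly_Mapping.lookup f u) (Poly_Mapping.lookup h (w - u)))"
proof -
  interpret vector_space s by (rule s)
  have "Poly_Mapping.lookup (act s f h) w = (\<Sum>u\<in>Poly_Mapping.keys f.
      \<Sum>x\<in>Poly_Mapping.keys h. if w - u = x then s (Poly_Mapping.lookup f u) (Poly_Mapping.lookup h x) else 0)"
    unfolding act_def lookup_sum
    by (intro sum.cong refl) (auto simp: lookup_single when_def algebra_simps)
  also have "\<dots> = (\<Sum>u\<in>Poly_Mapping.keys f. s (Poly_Mapping.lookup f u) (Poly_Mapping.lookup h (w - u)))"
    by (intro sum.cong refl) (auto simp: sum.delta' in_keys_iff)
  also have "\<dots> = (\<Sum>u\<in>A. s (Poly_Mapping.lookup f u) (Poly_Mapping.lookup h (w - u)))"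
    using A by (intro sum.mono_neutral_left) (auto simp: in_keys_iff)
  finally show ?thesis .
qed

lemmas lookup_act_keys = lookup_act[OF _ finite_keys subset_refl]

lemma lookup_act_single:
  assumes s: "vector_space s"
  shows "Poly_Mapping.lookup (act s f (Poly_Mapping.single u e)) w = s (Poly_Mapping.lookup f (w - u)) e"
proof -
  interpret vector_space s by (rule s)
  have "Poly_Mapping.lookup (act s f (Poly_Mapping.single u e)) w =
      (\<Sum>x\<in>insert (w - u) (Poly_Mapping.keys f). if x = w - u then s (Poly_Mapping.lookup f x) e else 0)"
    by (subst lookup_act[OF s, of "insert (w - u) (Poly_Mapping.keys f)"])
      (auto simp: lookup_single when_def algebra_simps intro!: sum.cong)
  then show ?thesis by simp
qed

lemma vector_space_mult: "vector_space ((*) :: 'k::field \<Rightarrow> 'k \<Rightarrow> 'k)"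
  by unfold_locales (auto simp: algebra_simps)

text \<open>
  The product of \<open>K[M]\<close> is the action on \<open>K[M] \<otimes> K\<close>. Functions can thus be handled as sections with
  \<open>E = K\<close>.
\<close>

lemma mult_eq_act: "f * g = act (*) f g"
proof (rule poly_mapping_eqI)
  fix w
  have "Poly_Mapping.lookup (f * g) w = (\<Sum>l. Poly_Mapping.lookup f l * Poly_Mapping.lookup g (w - l))"
  proof -
    have "w = l + q \<longleftrightarrow> q = w - l" for l q
      by (auto simp: algebra_simps)
    then show ?thesis
      by (simp add: lookup_mult)
  qed
  also have "\<dots> = (\<Sum>l\<in>Poly_Mapping.keys f. Poly_Mapping.lookup f l * Poly_Mapping.lookup g (w - l))"
    by (rule Sum_any.expand_superset) (auto simp: in_keys_iff)
  also have "\<dots> = Poly_Mapping.lookup (act (*) f g) w"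
    by (simp add: lookup_act_keys[OF vector_space_mult])
  finally show "Poly_Mapping.lookup (f * g) w = Poly_Mapping.lookup (act (*) f g) w" .
qed

lemma act_add_left:
  assumes s: "vector_space s"
  shows "act s (f + g) h = act s f h + act s g h"
proof (rule poly_mapping_eqI)
  fix w
  interpret vector_space s by (rule s)
  have "Poly_Mapping.keys (f + g) \<subseteq> Poly_Mapping.keys f \<union> Poly_Mapping.keys g"
    by (rule keys_add)
  then show "Poly_Mapping.lookup (act s (f + g) h) w = Poly_Mapping.lookup (act s f h + act s g h) w"
    by (simp add: lookup_act[OF s, of "Poly_Mapping.keys f \<union> Poly_Mapping.keys g"] lookup_add
        scale_left_distrib sum.distrib)
qed

lemma act_zero_left: "act s 0 h = 0"
  by (simp add: act_def)

lemma act_sum_left: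
  "vector_space s \<Longrightarrow> act s (\<Sum>i\<in>I. f i) h = (\<Sum>i\<in>I. act s (f i) h)"
  by (induction I rule: infinite_finite_induct) (simp_all add: act_zero_left act_add_left)

lemma act_one:
  assumes s: "vector_space s"
  shows "act s 1 h = h"
proof (rule poly_mapping_eqI)
  fix w
  interpret vector_space s by (rule s)
  show "Poly_Mapping.lookup (act s 1 h) w = Poly_Mapping.lookup h w"
    by (simp add: lookup_act[OF s, of "{0}"] single_one[symmetric] del: single_one)
qed

text \<open>
  The terms of a combination are indexed by distinct elements of \<open>X\<close>; an arbitrary indexed sum becomes
  one by collecting the coefficients of equal elements.
\<close>

lemma act_in_combinations_sum:
  assumes s: "vector_space s" and R: "0 \<in> R" "\<And>f g. f \<in> R \<Longrightarrow> g \<in> R \<Longrightarrow> f + g \<in> R"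
    and I: "finite I" "\<And>i. i \<in> I \<Longrightarrow> f i \<in> R" "\<And>i. i \<in> I \<Longrightarrow> x i \<in> X"
  shows "(\<Sum>i\<in>I. act s (f i) (x i)) \<in> combinations s R X"
proof -
  define g where "g y = (\<Sum>i | i \<in> I \<and> x i = y. f i)" for y
  have sumR: "(\<Sum>i\<in>J. f i) \<in> R" if "J \<subseteq> I" for J
    using that by (induction J rule: infinite_finite_induct) (auto intro: R I(2))
  have "(\<Sum>i\<in>I. act s (f i) (x i)) = (\<Sum>y\<in>x ` I. \<Sum>i | i \<in> I \<and> x i = y. act s (f i) (x i))"
    by (rule sum.image_gen[OF I(1)])
  also have "\<dots> = (\<Sum>y\<in>x ` I. act s (g y) y)"
    unfolding g_def act_sum_left[OF s] by (intro sum.cong refl) auto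
  finally show ?thesis
    unfolding combinations_def using I sumR
    by (auto simp: g_def intro!: exI[of _ "x ` I"] exI[of _ g])
qed

section \<open>Bases\<close>

lemma is_basis_iff:
  fixes s :: "'k::field \<Rightarrow> 'e::ab_group_add \<Rightarrow> 'e"
  assumes s: "vector_space s"
  shows "is_basis s r b \<longleftrightarrow> (\<forall>e. \<exists>c. e = (\<Sum>i<r. s (c i) (b i))) \<and>
    (\<forall>c. (\<Sum>i<r. s (c i) (b i)) = 0 \<longrightarrow> (\<forall>i<r. c i = 0))" (is "_ \<longleftrightarrow> ?span \<and> ?ind")
proof -
  interpret vector_space s by (rule s)
  show ?thesis
  proof (intro iffI conjI)
    assume b: "is_basis s r b"
    then have inj: "inj_on b {..<r}" and ind: "independent (b ` {..<r})" and span: "span (b ` {..<r}) = UNIV"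
      by (auto simp: is_basis_def)
    have re: "(\<Sum>i<r. s (d (b i)) (b i)) = (\<Sum>x\<in>b ` {..<r}. s (d x) x)" for d
      by (simp add: sum.reindex[OF inj])
    show ?span
    proof
      fix e
      have "e \<in> span (b ` {..<r})" by (simp add: span)
      then obtain d where "e = (\<Sum>x\<in>b ` {..<r}. s (d x) x)"
        by (auto simp: span_finite)
      then show "\<exists>c. e = (\<Sum>i<r. s (c i) (b i))"
        by (intro exI[of _ "d \<circ> b"]) (simp add: re)
    qed
    show ?ind
    proof (intro allI impI)
      fix c i assume c: "(\<Sum>i<r. s (c i) (b i)) = 0" and i: "i < r"
      define d where "d = c \<circ> the_inv_into {..<r} b"
      have d: "d (b j) = c j" if "j < r" for j
        using that inj by (simp add: d_def the_inv_into_f_f)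
      have "(\<Sum>x\<in>b ` {..<r}. s (d x) x) = 0"
        using c d by (simp flip: re)
      then have "d (b i) = 0"
        using independentD[OF ind, of "b ` {..<r}" d "b i"] i by auto
      with d i show "c i = 0" by simp
    qed
  next
    assume "?span \<and> ?ind"
    then have span: ?span and ind: ?ind by auto
    have inj: "inj_on b {..<r}"
    proof (rule inj_onI, rule ccontr)
      fix i j assume ij: "i \<in> {..<r}" "j \<in> {..<r}" "b i = b j" "i \<noteq> j"
      define d :: "nat \<Rightarrow> 'k" where "d k = (if k = i then 1 else 0) - (if k = j then 1 else 0)" for k
      have "s (d k) x = (if k = i then x else 0) - (if k = j then x else 0)" for k x
        by (simp add: d_def)
      then have "(\<Sum>k<r. s (d k) (b k)) = 0"
        using ij by (simp add: sum_subtractf)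
      then have "\<forall>k<r. d k = 0"
        using ind by blast
      with ij show False by (auto simp: d_def dest!: spec[of _ i])
    qed
    have "independent (b ` {..<r})"
    proof (rule independent_if_scalars_zero)
      fix d x assume d: "(\<Sum>x\<in>b ` {..<r}. s (d x) x) = 0" and x: "x \<in> b ` {..<r}"
      then have "(\<Sum>i<r. s (d (b i)) (b i)) = 0"
        by (simp add: sum.reindex[OF inj])
      then have "\<forall>i<r. d (b i) = 0"
        using ind[THEN spec, of "\<lambda>i. d (b i)"] by blast
      with x show "d x = 0" by auto
    qed simp
    moreover have "span (b ` {..<r}) = UNIV"
    proof -
      have "e \<in> span (b ` {..<r})" for e
      proof -
        obtain c where "e = (\<Sum>i<r. s (c i) (b i))" using span by blast
        then show ?thesis
          by (auto intro!: span_sum span_scale intro: span_base)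
      qed
      then show ?thesis by auto
    qed
    ultimately show "is_basis s r b"
      using inj by (simp add: is_basis_def)
  qed
qed

lemma basis_coordinates_unique:
  assumes s: "vector_space s" and b: "is_basis s r b"
    and eq: "(\<Sum>i<r. s (c i) (b i)) = (\<Sum>i<r. s (d i) (b i))" and i: "i < r"
  shows "c i = d i"
proof -
  interpret vector_space s by (rule s)
  have "(\<Sum>i<r. s (c i - d i) (b i)) = 0"
    using eq by (simp add: scale_left_diff_distrib sum_subtractf)
  then have "c i - d i = 0"
    using b i unfolding is_basis_iff[OF s] by (auto dest!: spec[of _ "\<lambda>i. c i - d i"])
  then show ?thesis by simp
qed

lemma basis_coordinatesE:
  assumes s: "vector_space s" and b: "is_basis s r b"
  obtains c where "\<And>e. e = (\<Sum>i<r. s (c e i) (b i))"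
proof -
  have "\<forall>e. \<exists>c. e = (\<Sum>i<r. s (c i) (b i))"
    using b unfolding is_basis_iff[OF s] by (rule conjunct1)
  from choice[OF this] that show ?thesis by blast
qed

lemma basis_independent:
  assumes "vector_space s" "is_basis s r b" "(\<Sum>i<r. s (c i) (b i)) = 0" "i < r"
  shows "c i = 0"
proof -
  interpret vector_space s by (rule assms(1))
  show ?thesis
    using basis_coordinates_unique[OF assms(1,2), of c "\<lambda>_. 0"] assms(3,4) by simp
qed

section \<open>Split modules\<close>

text \<open>
  In each degree a section of a split module is a vector expressed in the basis \<open>b\<close>. All statements about
  split modules are reduced to coordinates by this formula.
\<close>

lemma lookup_splitting_sum:
  assumes "vector_space s"
  shows "Poly_Mapping.lookup (\<Sum>i<r. act s (f i) (Poly_Mapping.single (- u i) (b i))) w =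
    (\<Sum>i<r. s (Poly_Mapping.lookup (f i) (w + u i)) (b i))"
  by (simp add: lookup_sum lookup_act_single[OF assms])

lemma splitting_sum_eq_zeroD:
  assumes s: "vector_space s" and b: "is_basis s r b"
    and zero: "(\<Sum>i<r. act s (f i) (Poly_Mapping.single (- u i) (b i))) = 0" and i: "i < r"
  shows "f i = 0"
proof (rule poly_mapping_eqI)
  fix w
  have "(\<Sum>j<r. s (Poly_Mapping.lookup (f j) (w - u i + u j)) (b j)) = 0"
    using zero by (simp flip: lookup_splitting_sum[OF s])
  from basis_independent[OF s b this i] show "Poly_Mapping.lookup (f i) w = Poly_Mapping.lookup 0 w"
    by simp
qed

lemma splitting_generator_mem:
  fixes R :: "('m::ab_group_add \<Rightarrow>\<^sub>0 'k::field) set" and H :: "('m \<Rightarrow>\<^sub>0 'e::ab_group_add) set"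
  assumes s: "vector_space s" and split: "splitting s r R H b u" and R: "0 \<in> R" "1 \<in> R" and i: "i < r"
  shows "Poly_Mapping.single (- u i) (b i) \<in> H"
proof -
  have "act s (if j = i then 1 else 0) h = (if j = i then h else 0)" for j and h :: "'m \<Rightarrow>\<^sub>0 'e"
    by (simp add: act_zero_left act_one[OF s])
  then have "(\<Sum>j<r. act s (if j = i then 1 else 0) (Poly_Mapping.single (- u j) (b j))) =
      Poly_Mapping.single (- u i) (b i)"
    using i by simp
  moreover have "\<forall>j<r. (if j = i then 1 else 0) \<in> R"
    using R by simp
  ultimately show ?thesis
    using split unfolding splitting_def
    by (auto intro!: exI[of _ "\<lambda>j. if j = i then 1 else 0"])
qed

text \<open>
  The generators are a global basis, so that the trivial covering \<open>D(1)\<close> works.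
\<close>

lemma locally_free_if_splitting:
  assumes s: "vector_space s" and split: "splitting s r R H b u" and R: "0 \<in> R" "1 \<in> R"
  shows "locally_free s r R H"
  unfolding locally_free_def
proof (intro exI[of _ "{1}"] conjI ballI)
  show "\<exists>a. a ` {1} \<subseteq> R \<and> (\<Sum>f\<in>{1}. a f * f) = 1"
    using R by (intro exI[of _ "\<lambda>_. 1"]) simp
  fix f :: "'c \<Rightarrow>\<^sub>0 'a" assume f: "f \<in> {1}"
  let ?h = "\<lambda>i. Poly_Mapping.single (- u i) (b i)"
  show "\<exists>h. (\<forall>i<r. h i \<in> H) \<and>
        (\<forall>x\<in>H. \<exists>k c. (\<forall>i<r. c i \<in> R) \<and> act s (f ^ k) x = (\<Sum>i<r. act s (c i) (h i))) \<and>
        (\<forall>c. (\<forall>i<r. c i \<in> R) \<and> (\<Sum>i<r. act s (c i) (h i)) = 0 \<longrightarrow> (\<forall>i<r. c i = 0))"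
  proof (intro exI[of _ ?h] conjI ballI allI impI)
    show "?h i \<in> H" if "i < r" for i
      by (rule splitting_generator_mem[OF s split R that])
    show "\<exists>k c. (\<forall>i<r. c i \<in> R) \<and> act s (f ^ k) x = (\<Sum>i<r. act s (c i) (?h i))" if "x \<in> H" for x
      using that split f by (auto simp: splitting_def act_one[OF s])
    show "c i = 0" if "(\<forall>i<r. c i \<in> R) \<and> (\<Sum>i<r. act s (c i) (?h i)) = 0" "i < r" for c i
      using splitting_sum_eq_zeroD[OF s _ _ that(2)] split that(1) by (auto simp: splitting_def)
  qed
qed (use R in auto)

lemma splitting_UNIV:
  assumes s: "vector_space s" and split: "splitting s r UNIV H b u"
  shows "H = UNIV"
proof -
  have b: "is_basis s r b" using split by (simp add: splitting_def)
  have "h \<in> H" for h :: "'c \<Rightarrow>\<^sub>0 'b"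
  proof -
    obtain c where c: "\<And>e. e = (\<Sum>i<r. s (c e i) (b i))"
      by (rule basis_coordinatesE[OF s b]) blast
    define f where "f i = (\<Sum>w\<in>Poly_Mapping.keys h.
        Poly_Mapping.single (w + u i) (c (Poly_Mapping.lookup h w) i))" for i
    have f: "Poly_Mapping.lookup (f i) (w + u i) =
        (if w \<in> Poly_Mapping.keys h then c (Poly_Mapping.lookup h w) i else 0)" for i w
      by (simp add: f_def lookup_sum lookup_single when_def sum.delta')
    interpret vector_space s by (rule s)
    have "h = (\<Sum>i<r. act s (f i) (Poly_Mapping.single (- u i) (b i)))"
    proof (rule poly_mapping_eqI)
      fix w
      show "Poly_Mapping.lookup h w =
          Poly_Mapping.lookup (\<Sum>i<r. act s (f i) (Poly_Mapping.single (- u i) (b i))) w"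
        using c[of "Poly_Mapping.lookup h w"]
        by (cases "Poly_Mapping.lookup h w = 0") (simp_all add: lookup_splitting_sum[OF s] f in_keys_iff)
    qed
    then show ?thesis
      using split by (auto simp: splitting_def)
  qed
  then show ?thesis by auto
qed

section \<open>Norms and apartments\<close>

lemma finite_INF_attained:
  fixes f :: "'i \<Rightarrow> 'a::complete_linorder"
  assumes "finite A" "A \<noteq> {}"
  shows "\<exists>j\<in>A. (INF i\<in>A. f i) = f j"
proof -
  have "Min (f ` A) \<in> f ` A"
    using assms by (intro Min_in) auto
  then show ?thesis
    using assms by (auto simp: Min_Inf)
qed

text \<open>
  Used to replace a basis adapted to \<open>\<Phi>(\<nu>, 1)\<close> by multiples that generate the lattice \<open>\<Lambda>\<close>.
\<close>

lemma apartment_rescale: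
  assumes val: "discrete_valuation val \<pi>" and s: "vector_space s"
    and \<omega>: "\<omega> \<in> apartment val s m r b" and a: "\<And>i. i < r \<Longrightarrow> a i \<noteq> 0"
  shows "\<omega> \<in> apartment val s m r (\<lambda>i. s (a i) (b i))"
proof -
  interpret discrete_valuation val \<pi> by (rule val)
  interpret vector_space s by (rule s)
  have norm: "additive_norm val s m \<omega>"
    using \<omega> by (simp add: apartment_def)
  have "\<omega> (\<Sum>i<r. s (c i) (s (a i) (b i))) =
      (INF i\<in>{i. i < r \<and> c i \<noteq> 0}. ereal (m * of_int (val (c i))) + \<omega> (s (a i) (b i)))" for c
  proof -
    have "\<omega> (\<Sum>i<r. s (c i) (s (a i) (b i))) = \<omega> (\<Sum>i<r. s (c i * a i) (b i))"
      by simp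
    also have "\<dots> = (INF i\<in>{i. i < r \<and> c i * a i \<noteq> 0}. ereal (m * of_int (val (c i * a i))) + \<omega> (b i))"
      using \<omega> by (simp only: apartment_def mem_Collect_eq)
    also have "\<dots> = (INF i\<in>{i. i < r \<and> c i \<noteq> 0}. ereal (m * of_int (val (c i))) + \<omega> (s (a i) (b i)))"
    proof (rule INF_cong)
      show "{i. i < r \<and> c i * a i \<noteq> 0} = {i. i < r \<and> c i \<noteq> 0}"
        using a by auto
      fix i assume "i \<in> {i. i < r \<and> c i \<noteq> 0}"
      then have i: "c i \<noteq> 0" "a i \<noteq> 0" using a by auto
      then have "\<omega> (s (a i) (b i)) = ereal (m * of_int (val (a i))) + \<omega> (b i)"
        using norm unfolding additive_norm_def by blast
      then show "ereal (m * of_int (val (c i * a i))) + \<omega> (b i) =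
          ereal (m * of_int (val (c i))) + \<omega> (s (a i) (b i))"
        using i by (simp add: val_mult distrib_left plus_ereal.simps(1)[symmetric] add.assoc
            del: plus_ereal.simps(1))
    qed
    finally show ?thesis .
  qed
  with norm show ?thesis by (simp add: apartment_def)
qed

lemma ex_valuation_adapted:
  assumes s: "vector_space s" and b: "is_basis s r b"
  shows "\<exists>\<omega>\<in>apartment_sph s r b. \<forall>i<r. \<omega> (b i) = ereal (a i)"
proof -
  interpret vector_space s by (rule s)
  obtain co where co: "\<And>e. e = (\<Sum>i<r. s (co e i) (b i))"
    by (rule basis_coordinatesE[OF s b]) blast
  have co_eq: "co e i = d i" if "e = (\<Sum>i<r. s (d i) (b i))" "i < r" for e d i
    using basis_coordinates_unique[OF s b, of "co e" d] co[of e] that by simp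
  define supp where "supp e = {i. i < r \<and> co e i \<noteq> 0}" for e
  have supp_finite: "finite (supp e)" for e
    by (simp add: supp_def)
  have supp_sum: "supp (\<Sum>i<r. s (d i) (b i)) = {i. i < r \<and> d i \<noteq> 0}" for d
    using co_eq[OF refl] by (auto simp: supp_def)
  \<comment> \<open>The infimum over the support gives \<open>\<infinity>\<close> at \<open>0\<close>, and the norm axioms become
    statements about supports.\<close>
  define \<omega> where "\<omega> e = (INF i\<in>supp e. ereal (a i))" for e
  have supp_b: "supp (b j) = {j}" if "j < r" for j
  proof -
    have "(\<Sum>i<r. s (if i = j then 1 else 0) (b i)) = (\<Sum>i<r. if i = j then b i else 0)"
      by (rule sum.cong) auto
    also have "\<dots> = b j" using that by simp
    finally show ?thesis
      using supp_sum[of "\<lambda>i. if i = j then 1 else 0"] that by auto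
  qed
  have \<omega>b: "\<omega> (b j) = ereal (a j)" if "j < r" for j
    by (simp add: \<omega>_def supp_b that)
  have "additive_norm (\<lambda>_. 0) s 0 \<omega>"
    unfolding additive_norm_def
  proof (intro conjI allI impI)
    show "\<omega> e \<noteq> - \<infinity>" for e
      using finite_INF_attained[OF supp_finite, of e "\<lambda>i. ereal (a i)"]
      by (cases "supp e = {}") (auto simp: \<omega>_def top_ereal_def)
    show "\<omega> e = \<infinity> \<longleftrightarrow> e = 0" for e
    proof
      assume "\<omega> e = \<infinity>"
      then have "supp e = {}"
        using finite_INF_attained[OF supp_finite, of e "\<lambda>i. ereal (a i)"] by (auto simp: \<omega>_def)
      then have "(\<Sum>i<r. s (co e i) (b i)) = 0"
        by (intro sum.neutral) (auto simp: supp_def)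
      with co[of e] show "e = 0" by simp
    next
      assume "e = 0"
      then have "supp e = {}"
        using supp_sum[of "\<lambda>_. 0"] by simp
      then show "\<omega> e = \<infinity>"
        by (simp add: \<omega>_def top_ereal_def)
    qed
    show "\<omega> (s c e) = ereal (0 * real_of_int 0) + \<omega> e" if "c \<noteq> 0" for c e
    proof -
      have "s c e = (\<Sum>i<r. s (c * co e i) (b i))"
        using arg_cong[OF co[of e], of "s c"] by (simp add: scale_sum_right)
      then have "supp (s c e) = supp e"
        using that by (simp add: supp_sum) (simp add: supp_def)
      then show ?thesis by (simp add: \<omega>_def)
    qed
    show "min (\<omega> e) (\<omega> e') \<le> \<omega> (e + e')" for e e'
    proof -
      have "e + e' = (\<Sum>i<r. s (co e i + co e' i) (b i))"
        using co[of e] co[of e'] by (simp add: scale_left_distrib sum.distrib)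
      from arg_cong[OF this, of supp] have "supp (e + e') = {i. i < r \<and> co e i + co e' i \<noteq> 0}"
        by (simp add: supp_sum)
      also have "\<dots> \<subseteq> supp e \<union> supp e'"
        by (auto simp: supp_def)
      finally have "supp (e + e') \<subseteq> supp e \<union> supp e'" .
      then have "(INF i\<in>supp e \<union> supp e'. ereal (a i)) \<le> \<omega> (e + e')"
        unfolding \<omega>_def by (intro INF_superset_mono) auto
      then show ?thesis
        by (simp add: \<omega>_def INF_union inf_min)
    qed
  qed
  moreover have "\<omega> (\<Sum>i<r. s (d i) (b i)) =
      (INF i\<in>{i. i < r \<and> d i \<noteq> 0}. ereal (0 * real_of_int 0) + \<omega> (b i))" for d
    unfolding \<omega>_def[of "\<Sum>i<r. s (d i) (b i)"] supp_sum by (intro INF_cong refl) (simp add: \<omega>b)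
  ultimately have "\<omega> \<in> apartment_sph s r b"
    by (simp add: apartment_def)
  with \<omega>b show ?thesis by blast
qed

lemma apartment_sph_scale:
  fixes s :: "'k::field \<Rightarrow> 'e::ab_group_add \<Rightarrow> 'e"
  assumes \<omega>: "\<omega> \<in> apartment_sph s r b" and \<epsilon>: "0 < \<epsilon>"
  shows "(\<lambda>e. ereal \<epsilon> * \<omega> e) \<in> apartment_sph s r b"
proof -
  have norm: "additive_norm (\<lambda>_. 0) s 0 \<omega>"
    and adapted: "\<And>c. \<omega> (\<Sum>i<r. s (c i) (b i)) = (INF i\<in>{i. i < r \<and> c i \<noteq> 0}. \<omega> (b i))"
    using \<omega> by (auto simp: apartment_def)
  have mono: "x \<le> y \<Longrightarrow> ereal \<epsilon> * x \<le> ereal \<epsilon> * y" for x y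
    using \<epsilon> by (intro ereal_mult_left_mono) auto
  have "additive_norm (\<lambda>_. 0) s 0 (\<lambda>e. ereal \<epsilon> * \<omega> e)"
    unfolding additive_norm_def
  proof (intro conjI allI impI)
    fix e e'
    have fin: "\<omega> e \<noteq> - \<infinity>" and inf: "\<omega> e = \<infinity> \<longleftrightarrow> e = 0"
      and add: "min (\<omega> e) (\<omega> e') \<le> \<omega> (e + e')"
      using norm by (simp_all add: additive_norm_def)
    show "ereal \<epsilon> * \<omega> e \<noteq> - \<infinity>"
      using fin \<epsilon> by (cases "\<omega> e") auto
    show "ereal \<epsilon> * \<omega> e = \<infinity> \<longleftrightarrow> e = 0"
      using inf fin \<epsilon> by (cases "\<omega> e") auto
    show "min (ereal \<epsilon> * \<omega> e) (ereal \<epsilon> * \<omega> e') \<le> ereal \<epsilon> * \<omega> (e + e')"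
      using add mono by (auto simp: min_le_iff_disj)
    fix c :: 'k assume "c \<noteq> 0"
    then have "\<omega> (s c e) = \<omega> e"
      using norm by (simp add: additive_norm_def)
    then show "ereal \<epsilon> * \<omega> (s c e) = ereal (0 * real_of_int 0) + ereal \<epsilon> * \<omega> e"
      by simp
  qed
  moreover have "ereal \<epsilon> * (INF i\<in>A. \<omega> (b i)) = (INF i\<in>A. ereal \<epsilon> * \<omega> (b i))" if A: "finite A" for A
  proof (cases "A = {}")
    case True
    then show ?thesis using \<epsilon> by (simp add: top_ereal_def)
  next
    case False
    obtain j where j: "j \<in> A" "(INF i\<in>A. \<omega> (b i)) = \<omega> (b j)"
      using finite_INF_attained[OF A False] by blast
    show ?thesis
    proof (rule antisym)
      show "ereal \<epsilon> * (INF i\<in>A. \<omega> (b i)) \<le> (INF i\<in>A. ereal \<epsilon> * \<omega> (b i))"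
        by (intro INF_greatest mono INF_lower)
      show "(INF i\<in>A. ereal \<epsilon> * \<omega> (b i)) \<le> ereal \<epsilon> * (INF i\<in>A. \<omega> (b i))"
        unfolding j(2) by (rule INF_lower[OF j(1)])
    qed
  qed
  ultimately show ?thesis
    by (simp add: apartment_def adapted)
qed

section \<open>Reduction of a lattice\<close>

context discrete_valuation
begin

lemma val_one [simp]: "val 1 = 0"
  using val_mult[of 1 1] by simp

lemma val_inverse: "x \<noteq> 0 \<Longrightarrow> val (inverse x) = - val x"
  using val_mult[of x "inverse x"] by simp

lemma val_power: "val (\<pi> ^ n) = int n"
  by (induction n) (simp_all add: val_mult unif_nonzero val_unif)

lemma val_powi: "val (\<pi> powi k) = k"
  by (cases "0 \<le> k") (simp_all add: power_int_def val_power val_inverse unif_nonzero power_inverse)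

lemma zero_valring [simp]: "0 \<in> valring val"
  and one_valring [simp]: "1 \<in> valring val"
  by (auto simp: valring_def)

lemma valring_add: "x \<in> valring val \<Longrightarrow> y \<in> valring val \<Longrightarrow> x + y \<in> valring val"
  using val_add[of x y]
  by (cases "x = 0"; cases "y = 0"; cases "x + y = 0") (auto simp: valring_def)

lemma valring_mult: "x \<in> valring val \<Longrightarrow> y \<in> valring val \<Longrightarrow> x * y \<in> valring val"
  by (cases "x = 0"; cases "y = 0") (auto simp: valring_def val_mult)

end

text \<open>
  A module over the valuation ring with a semilinear map to a vector space over the residue field. Besides
  \<open>\<Lambda> \<rightarrow> E\<^sub>\<Lambda>\<close> this covers \<open>\<O> \<rightarrow> \<kk>\<close> itself, so that the restriction of functions and of
  sections to the component can be treated at once.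
\<close>

locale reduction = discrete_valuation val \<pi> for val :: "'k::field \<Rightarrow> int" and \<pi> :: 'k +
  fixes res :: "'k \<Rightarrow> 'f::field" and s :: "'k \<Rightarrow> 'e::ab_group_add \<Rightarrow> 'e"
    and sg :: "'f \<Rightarrow> 'g::ab_group_add \<Rightarrow> 'g" and \<Lambda> :: "'e set" and q :: "'e \<Rightarrow> 'g"
  assumes residue: "residue_map val res"
    and vector_space: "vector_space s" and vector_space_residue: "vector_space sg"
    and zero_mem: "0 \<in> \<Lambda>" and add_mem: "e \<in> \<Lambda> \<Longrightarrow> e' \<in> \<Lambda> \<Longrightarrow> e + e' \<in> \<Lambda>"
    and scale_mem: "a \<in> valring val \<Longrightarrow> e \<in> \<Lambda> \<Longrightarrow> s a e \<in> \<Lambda>"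
    and q_add: "e \<in> \<Lambda> \<Longrightarrow> e' \<in> \<Lambda> \<Longrightarrow> q (e + e') = q e + q e'"
    and q_scale: "a \<in> valring val \<Longrightarrow> e \<in> \<Lambda> \<Longrightarrow> q (s a e) = sg (res a) (q e)"
begin

lemma q_zero [simp]: "q 0 = 0"
  using q_add[OF zero_mem zero_mem] by simp

lemma sum_mem: "(\<And>i. i \<in> I \<Longrightarrow> e i \<in> \<Lambda>) \<Longrightarrow> (\<Sum>i\<in>I. e i) \<in> \<Lambda>"
  by (induction I rule: infinite_finite_induct) (auto intro: zero_mem add_mem)

lemma q_sum: "(\<And>i. i \<in> I \<Longrightarrow> e i \<in> \<Lambda>) \<Longrightarrow> q (\<Sum>i\<in>I. e i) = (\<Sum>i\<in>I. q (e i))"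
  by (induction I rule: infinite_finite_induct) (auto simp: q_add sum_mem)

lemma res_zero [simp]: "res 0 = 0" and res_one [simp]: "res 1 = 1"
  using residue by (auto simp: residue_map_def)

lemma res_eq_0_iff: "x \<in> valring val \<Longrightarrow> res x = 0 \<longleftrightarrow> x = 0 \<or> 0 < val x"
  using residue by (auto simp: residue_map_def)

lemma res_lift: "\<exists>x\<in>valring val. res x = y"
  using residue unfolding residue_map_def by (metis UNIV_I imageE)

lemma scalar_reduction: "reduction val \<pi> res (*) (*) (valring val) res"
  using residue by unfold_locales
    (auto simp: residue_map_def valring_add valring_mult algebra_simps)

lemma lattice_basis_mem:
  assumes "lattice_basis val s r \<Lambda> b" "i < r"
  shows "b i \<in> \<Lambda>"
proof -
  interpret vector_space s by (rule vector_space)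
  have "(\<Sum>j<r. s (if j = i then 1 else 0) (b j)) = (\<Sum>j<r. if j = i then b j else 0)"
    by (rule sum.cong) auto
  also have "\<dots> = b i" using assms(2) by simp
  finally have "b i = (\<Sum>j<r. s (if j = i then 1 else 0) (b j))" by simp
  then show ?thesis
    using assms(1) unfolding lattice_basis_def
    by (auto intro!: exI[of _ "\<lambda>j. if j = i then 1 else 0"])
qed

lemma q_combination:
  assumes "lattice_basis val s r \<Lambda> b" "\<forall>i<r. a i \<in> valring val"
  shows "q (\<Sum>i<r. s (a i) (b i)) = (\<Sum>i<r. sg (res (a i)) (q (b i)))"
  using assms lattice_basis_mem[OF assms(1)] by (subst q_sum) (auto simp: q_scale scale_mem)

text \<open>
  Nakayama's lemma in its trivial case of a free module: a relation among the reductions lifts to an element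
  of \<open>\<pi>\<Lambda>\<close>, whose coordinates are divisible by \<open>\<pi>\<close>.
\<close>

lemma is_basis_reduction:
  assumes red: "lattice_reduction val \<pi> res s sg \<Lambda> q" and b: "lattice_basis val s r \<Lambda> b"
  shows "is_basis sg r (q \<circ> b)"
  unfolding is_basis_iff[OF vector_space_residue]
proof (intro conjI allI impI)
  interpret vector_space s by (rule vector_space)
  have \<Lambda>: "\<Lambda> = {\<Sum>i<r. s (a i) (b i) | a. \<forall>i<r. a i \<in> valring val}"
    using b by (simp add: lattice_basis_def)
  fix g
  obtain e where "e \<in> \<Lambda>" "q e = g"
    using red unfolding lattice_reduction_def by (metis UNIV_I imageE)
  then obtain a where "\<forall>i<r. a i \<in> valring val" "q (\<Sum>i<r. s (a i) (b i)) = g"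
    unfolding \<Lambda> by auto
  then show "\<exists>c. g = (\<Sum>i<r. sg (c i) ((q \<circ> b) i))"
    using q_combination[OF b] by (intro exI[of _ "\<lambda>i. res (a i)"]) auto
next
  interpret vector_space s by (rule vector_space)
  have \<Lambda>: "\<Lambda> = {\<Sum>i<r. s (a i) (b i) | a. \<forall>i<r. a i \<in> valring val}"
    using b by (simp add: lattice_basis_def)
  fix c i assume c: "(\<Sum>i<r. sg (c i) ((q \<circ> b) i)) = 0" and i: "i < r"
  obtain a where a: "\<And>j. a j \<in> valring val" "\<And>j. res (a j) = c j"
  proof -
    have "\<forall>j. \<exists>x. x \<in> valring val \<and> res x = c j"
      using res_lift by blast
    from choice[OF this] show ?thesis using that by blast
  qed
  have "q (\<Sum>j<r. s (a j) (b j)) = 0"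
    using c a by (simp add: q_combination[OF b])
  moreover have "(\<Sum>j<r. s (a j) (b j)) \<in> \<Lambda>"
    unfolding \<Lambda> using a by auto
  ultimately have "(\<Sum>j<r. s (a j) (b j)) \<in> s \<pi> ` \<Lambda>"
    using red by (simp add: lattice_reduction_def)
  then obtain d where d: "\<forall>j<r. d j \<in> valring val"
      and eq: "(\<Sum>j<r. s (a j) (b j)) = s \<pi> (\<Sum>j<r. s (d j) (b j))"
    unfolding \<Lambda> by auto
  have "is_basis s r b"
    using b by (simp add: lattice_basis_def)
  moreover have "(\<Sum>j<r. s (a j) (b j)) = (\<Sum>j<r. s (\<pi> * d j) (b j))"
    using eq by (simp add: scale_sum_right)
  ultimately have "a i = \<pi> * d i"
    using basis_coordinates_unique[OF vector_space, where c = a and d = "\<lambda>j. \<pi> * d j"] i by blast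
  moreover have "d i = 0 \<or> 0 \<le> val (d i)"
    using d i by (simp add: valring_def)
  ultimately have "a i = 0 \<or> 0 < val (a i)"
    using val_mult[OF unif_nonzero, of "d i"] by (cases "d i = 0") (auto simp: val_unif)
  then show "c i = 0"
    using res_eq_0_iff[OF a(1)] a(2) by metis
qed

text \<open>
  The reduction of a norm takes at a class the maximum of the norm over all lifts. A lift in \<open>\<Lambda>\<close> with
  coordinates \<open>a\<^sub>i\<close> has norm at most the minimum of \<open>\<omega>(b\<^sub>i)\<close> over the unit coordinates, which depend only
  on the class.
\<close>

lemma link_identified_lift:
  assumes b: "lattice_basis val s r \<Lambda> b" and red: "q ` \<Lambda> = UNIV"
    and \<omega>: "\<omega> \<in> apartment val s 1 r b" and \<omega>': "\<omega>' \<in> apartment_sph sg r (q \<circ> b)"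
    and eq: "\<forall>i<r. \<omega>' (q (b i)) = \<omega> (b i)"
  shows "\<forall>e\<in>\<Lambda>. \<omega> e \<le> \<omega>' (q e)" and "\<exists>e\<in>\<Lambda>. q e = g \<and> \<omega> e = \<omega>' g"
proof -
  have \<Lambda>: "\<Lambda> = {\<Sum>i<r. s (a i) (b i) | a. \<forall>i<r. a i \<in> valring val}"
    using b by (simp add: lattice_basis_def)
  have \<omega>_sum: "\<omega> (\<Sum>i<r. s (a i) (b i)) = (INF i\<in>{i. i < r \<and> a i \<noteq> 0}. ereal (of_int (val (a i))) + \<omega> (b i))" for a
    using \<omega> by (simp add: apartment_def)
  have unit: "val x = 0" if "x \<in> valring val" "res x \<noteq> 0" for x
    using that res_eq_0_iff[OF that(1)] by (auto simp: valring_def)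
  have \<omega>'_sum: "\<omega>' (q (\<Sum>i<r. s (a i) (b i))) = (INF i\<in>{i. i < r \<and> res (a i) \<noteq> 0}. \<omega> (b i))"
    if "\<forall>i<r. a i \<in> valring val" for a
  proof -
    have "\<omega>' (q (\<Sum>i<r. s (a i) (b i))) = (INF i\<in>{i. i < r \<and> res (a i) \<noteq> 0}. \<omega>' (q (b i)))"
      using \<omega>' by (simp add: q_combination[OF b that] apartment_def)
    also have "\<dots> = (INF i\<in>{i. i < r \<and> res (a i) \<noteq> 0}. \<omega> (b i))"
      using eq by (intro INF_cong) auto
    finally show ?thesis .
  qed
  show "\<forall>e\<in>\<Lambda>. \<omega> e \<le> \<omega>' (q e)"
  proof
    fix e assume "e \<in> \<Lambda>"
    then obtain a where a: "e = (\<Sum>i<r. s (a i) (b i))" "\<forall>i<r. a i \<in> valring val"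
      unfolding \<Lambda> by auto
    show "\<omega> e \<le> \<omega>' (q e)"
      unfolding a(1) \<omega>'_sum[OF a(2)] unfolding \<omega>_sum
    proof (rule INF_greatest)
      fix i assume "i \<in> {i. i < r \<and> res (a i) \<noteq> 0}"
      then have "i \<in> {i. i < r \<and> a i \<noteq> 0}" "val (a i) = 0"
        using a(2) unit by auto
      then show "(INF i\<in>{i. i < r \<and> a i \<noteq> 0}. ereal (of_int (val (a i))) + \<omega> (b i)) \<le> \<omega> (b i)"
        by (intro INF_lower2[of i]) auto
    qed
  qed
  obtain e where "e \<in> \<Lambda>" "q e = g"
    using red by (metis UNIV_I imageE)
  then obtain a where a: "q (\<Sum>i<r. s (a i) (b i)) = g" "\<forall>i<r. a i \<in> valring val"
    unfolding \<Lambda> by auto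
  \<comment> \<open>The maximum is attained by the lift whose nonunit coordinates vanish.\<close>
  define a' where "a' i = (if res (a i) = 0 then 0 else a i)" for i
  have a': "\<forall>i<r. a' i \<in> valring val" "\<And>i. res (a' i) = res (a i)"
    using a by (auto simp: a'_def)
  show "\<exists>e\<in>\<Lambda>. q e = g \<and> \<omega> e = \<omega>' g"
  proof (intro bexI conjI)
    show g: "q (\<Sum>i<r. s (a' i) (b i)) = g"
      using a by (simp add: q_combination[OF b] a')
    show "(\<Sum>i<r. s (a' i) (b i)) \<in> \<Lambda>"
      unfolding \<Lambda> using a' by blast
    show "\<omega> (\<Sum>i<r. s (a' i) (b i)) = \<omega>' g"
      unfolding g[symmetric] \<omega>'_sum[OF a'(1)] unfolding \<omega>_sum
    proof (rule INF_cong)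
      show "{i. i < r \<and> a' i \<noteq> 0} = {i. i < r \<and> res (a' i) \<noteq> 0}"
        by (auto simp: a'_def)
      show "ereal (of_int (val (a' i))) + \<omega> (b i) = \<omega> (b i)" if "i \<in> {i. i < r \<and> res (a' i) \<noteq> 0}" for i
        using that a' unit[of "a' i"] by simp
    qed
  qed
qed

text \<open>
  The description by lifts does not mention the basis, so the identification with the link does not depend
  on it.
\<close>

lemma link_identified_unique:
  assumes red: "q ` \<Lambda> = UNIV"
    and \<omega>1: "link_identified val s sg r \<Lambda> q \<omega> \<omega>1" and \<omega>2: "link_identified val s sg r \<Lambda> q \<omega> \<omega>2"
  shows "\<omega>1 = \<omega>2"
proof -
  have "\<omega>1 g \<le> \<omega>2 g"
    if "link_identified val s sg r \<Lambda> q \<omega> \<omega>1" "link_identified val s sg r \<Lambda> q \<omega> \<omega>2" for \<omega>1 \<omega>2 g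
  proof -
    from that(1) obtain e where e: "e \<in> \<Lambda>" "q e = g" "\<omega> e = \<omega>1 g"
      unfolding link_identified_def using link_identified_lift(2)[OF _ red] by metis
    moreover from that(2) have "\<omega> e \<le> \<omega>2 (q e)"
      unfolding link_identified_def using link_identified_lift(1)[OF _ red] e(1) by metis
    ultimately show ?thesis by simp
  qed
  with \<omega>1 \<omega>2 show ?thesis by (intro ext antisym) auto
qed

end

section \<open>The rings of the affine charts\<close>

lemma sum_single_lookup:
  "(\<Sum>u\<in>Poly_Mapping.keys f. Poly_Mapping.single u (Poly_Mapping.lookup f u)) = f"
  by (rule poly_mapping_eqI) (simp add: lookup_sum lookup_single when_def sum.delta' in_keys_iff)

context dual_lattices
begin

lemma pr_zero [simp]: "pr 0 x = 0"
  using pr_add_left[of 0 0 x] by simp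

lemma pr_minus [simp]: "pr (- u) x = - pr u x"
  using pr_add_left[of u "- u" x] by simp

end

locale torus_over_dvr = dual_lattices n pr + discrete_valuation val \<pi>
  for n and pr :: "'m::ab_group_add \<Rightarrow> 'v::real_vector \<Rightarrow> real"
    and val :: "'k::field \<Rightarrow> int" and \<pi> :: 'k
begin

text \<open>
  The condition for \<open>a \<chi>\<^sup>u\<close> to be regular on the chart. The ring of the chart is defined by generators,
  whereas membership is decided degree by degree by this condition.
\<close>

definition regular_term :: "('v \<times> real) set \<Rightarrow> 'm \<Rightarrow> 'k \<Rightarrow> bool" where
  "regular_term \<sigma> u a \<longleftrightarrow> a = 0 \<or> (\<forall>(x, t)\<in>\<sigma>. 0 \<le> pr u x + of_int (val a) * t)"

context
  fixes \<sigma> :: "('v \<times> real) set"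
  assumes height: "\<forall>(x, t)\<in>\<sigma>. 0 \<le> t"
begin

lemma regular_term_zero [simp]: "regular_term \<sigma> u 0"
  by (simp add: regular_term_def)

lemma regular_term_mono:
  assumes "a \<noteq> 0" "regular_term \<sigma> u a" "val a \<le> val b"
  shows "regular_term \<sigma> u b"
proof -
  have "0 \<le> pr u x + of_int (val b) * t" if "(x, t) \<in> \<sigma>" for x t
  proof -
    have "0 \<le> pr u x + of_int (val a) * t" and "0 \<le> t"
      using assms(1,2) that height by (auto simp: regular_term_def)
    moreover have "of_int (val a) * t \<le> of_int (val b) * t"
      using assms(3) \<open>0 \<le> t\<close> by (intro mult_right_mono) auto
    ultimately show ?thesis by simp
  qed
  then show ?thesis by (auto simp: regular_term_def)
qed

lemma regular_term_add:
  assumes a: "regular_term \<sigma> u a" and b: "regular_term \<sigma> u b"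
  shows "regular_term \<sigma> u (a + b)"
proof (cases "a = 0 \<or> b = 0 \<or> a + b = 0")
  case False
  then have "val a \<le> val (a + b) \<or> val b \<le> val (a + b)"
    using val_add[of a b] by (auto simp: min_le_iff_disj)
  with False a b show ?thesis
    using regular_term_mono by metis
qed (use a b in auto)

lemma regular_term_sum:
  "(\<And>i. i \<in> I \<Longrightarrow> regular_term \<sigma> u (a i)) \<Longrightarrow> regular_term \<sigma> u (\<Sum>i\<in>I. a i)"
  by (induction I rule: infinite_finite_induct) (auto intro: regular_term_add)

lemma regular_term_mult:
  assumes "regular_term \<sigma> u a" "regular_term \<sigma> w b"
  shows "regular_term \<sigma> (u + w) (a * b)"
proof (cases "a = 0 \<or> b = 0")
  case False
  have "0 \<le> pr (u + w) x + of_int (val (a * b)) * t" if "(x, t) \<in> \<sigma>" for x t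
  proof -
    have "0 \<le> pr u x + of_int (val a) * t" "0 \<le> pr w x + of_int (val b) * t"
      using assms that False by (auto simp: regular_term_def)
    then show ?thesis
      using False by (simp add: val_mult pr_add_left algebra_simps)
  qed
  then show ?thesis by (auto simp: regular_term_def)
qed auto

lemma chart_ring_regular_term:
  "f \<in> chart_ring pr val \<pi> \<sigma> \<Longrightarrow> regular_term \<sigma> u (Poly_Mapping.lookup f u)"
proof (induction arbitrary: u rule: chart_ring.induct)
  case (scalar a)
  then show ?case
    using height by (auto simp: lookup_single when_def regular_term_def valring_def)
next
  case (monomial w k)
  then show ?case
    by (auto simp: lookup_single when_def regular_term_def val_powi)
next
  case (add f g)
  then show ?case
    by (simp add: lookup_add regular_term_add)
next
  case (mult f g)
  have "regular_term \<sigma> (x + (u - x)) (Poly_Mapping.lookup f x * Poly_Mapping.lookup g (u - x))" for x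
    using mult.IH by (rule regular_term_mult)
  then show ?case
    by (auto simp: mult_eq_act lookup_act_keys[OF vector_space_mult] intro!: regular_term_sum)
qed

lemma zero_chart_ring [simp]: "0 \<in> chart_ring pr val \<pi> \<sigma>"
  using chart_ring.scalar[of 0 val pr \<pi> \<sigma>] by simp

lemma one_chart_ring [simp]: "1 \<in> chart_ring pr val \<pi> \<sigma>"
  using chart_ring.scalar[of 1 val pr \<pi> \<sigma>] by simp

text \<open>
  Split off the unit \<open>a \<pi>\<^bsup>-val a\<^esup>\<close>, which is a scalar of the valuation ring.
\<close>

lemma single_chart_ring:
  assumes "regular_term \<sigma> u a"
  shows "Poly_Mapping.single u a \<in> chart_ring pr val \<pi> \<sigma>"
proof (cases "a = 0")
  case False
  define c where "c = a * inverse (\<pi> powi val a)"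
  have \<pi>: "\<pi> powi val a \<noteq> 0"
    by (simp add: unif_nonzero)
  have "val c = 0"
    using False \<pi> by (simp add: c_def val_mult val_inverse val_powi)
  then have "Poly_Mapping.single 0 c \<in> chart_ring pr val \<pi> \<sigma>"
    by (intro chart_ring.scalar) (simp add: valring_def)
  moreover have "Poly_Mapping.single u (\<pi> powi val a) \<in> chart_ring pr val \<pi> \<sigma>"
    using assms False by (intro chart_ring.monomial) (auto simp: regular_term_def)
  ultimately have "Poly_Mapping.single 0 c * Poly_Mapping.single u (\<pi> powi val a) \<in> chart_ring pr val \<pi> \<sigma>"
    by (rule chart_ring.mult)
  also have "Poly_Mapping.single 0 c * Poly_Mapping.single u (\<pi> powi val a) = Poly_Mapping.single u a"
    using \<pi> by (simp add: mult_single c_def mult.assoc del: power_int_eq_0_iff)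
  finally show ?thesis .
qed simp

lemma chart_ring_iff:
  "f \<in> chart_ring pr val \<pi> \<sigma> \<longleftrightarrow> (\<forall>u. regular_term \<sigma> u (Poly_Mapping.lookup f u))"
proof
  assume f: "\<forall>u. regular_term \<sigma> u (Poly_Mapping.lookup f u)"
  have "(\<Sum>u\<in>A. Poly_Mapping.single u (Poly_Mapping.lookup f u)) \<in> chart_ring pr val \<pi> \<sigma>" for A
    using f by (induction A rule: infinite_finite_induct) (auto intro: chart_ring.add single_chart_ring)
  from this[of "Poly_Mapping.keys f"] show "f \<in> chart_ring pr val \<pi> \<sigma>"
    by (simp only: sum_single_lookup)
qed (simp add: chart_ring_regular_term)

end

end

section \<open>Restriction of sections\<close>

locale component_reduction = torus_over_dvr n pr val \<pi> + reduction val \<pi> res s sg \<Lambda> q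
  for n and pr :: "'m::ab_group_add \<Rightarrow> 'v::real_vector \<Rightarrow> real"
    and val :: "'k::field \<Rightarrow> int" and \<pi> :: 'k and res :: "'k \<Rightarrow> 'f::field"
    and s :: "'k \<Rightarrow> 'e::ab_group_add \<Rightarrow> 'e" and sg :: "'f \<Rightarrow> 'g::ab_group_add \<Rightarrow> 'g" and \<Lambda> q +
  fixes \<nu> :: 'v
  assumes vertex_integral: "\<nu> \<in> lattice_N pr"
begin

text \<open>
  The \<open>K\<close>-point \<open>\<chi>\<^sup>u \<mapsto> \<pi>\<^bsup>\<langle>u,\<nu>\<rangle>\<^esup>\<close> of the torus extends to an \<open>\<O>\<close>-point of the chart of \<open>\<nu>\<close>, and
  its reduction is \<open>x\<^sub>\<nu>\<close>. Restriction to the component is multiplication by the twist in each degree followed by reduction.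
\<close>

definition twist :: "'m \<Rightarrow> 'k" where
  "twist u = \<pi> powi \<lfloor>pr u \<nu>\<rfloor>"

lemma floor_pr [simp]: "of_int \<lfloor>pr u \<nu>\<rfloor> = pr u \<nu>"
  using vertex_integral by (simp add: lattice_N_def)

lemma twist_nonzero [simp]: "twist u \<noteq> 0"
  by (simp add: twist_def unif_nonzero)

lemma val_twist: "of_int (val (twist u)) = pr u \<nu>"
  by (simp add: twist_def val_powi)

lemma twist_add: "twist (u + w) = twist u * twist w"
proof -
  have "real_of_int \<lfloor>pr (u + w) \<nu>\<rfloor> = real_of_int (\<lfloor>pr u \<nu>\<rfloor> + \<lfloor>pr w \<nu>\<rfloor>)"
    by (simp only: of_int_add floor_pr) (rule pr_add_left)
  then have "\<lfloor>pr (u + w) \<nu>\<rfloor> = \<lfloor>pr u \<nu>\<rfloor> + \<lfloor>pr w \<nu>\<rfloor>"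
    by (simp only: of_int_eq_iff)
  then show ?thesis
    by (simp add: twist_def power_int_add unif_nonzero)
qed

definition integral_section :: "('m \<Rightarrow>\<^sub>0 'e) \<Rightarrow> bool" where
  "integral_section h \<longleftrightarrow> (\<forall>u. s (twist u) (Poly_Mapping.lookup h u) \<in> \<Lambda>)"

definition integral_function :: "('m \<Rightarrow>\<^sub>0 'k) \<Rightarrow> bool" where
  "integral_function f \<longleftrightarrow> (\<forall>u. twist u * Poly_Mapping.lookup f u \<in> valring val)"

lemma lookup_restrict_section:
  "Poly_Mapping.lookup (restrict_section pr \<pi> s q \<nu> h) u = q (s (twist u) (Poly_Mapping.lookup h u))"
proof -
  interpret vector_space s by (rule vector_space)
  show ?thesis
    unfolding restrict_section_def lookup_sum lookup_single when_def
    by (simp add: sum.delta' in_keys_iff twist_def)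
qed

lemma lookup_restrict_function:
  "Poly_Mapping.lookup (restrict_function pr \<pi> res \<nu> f) u = res (twist u * Poly_Mapping.lookup f u)"
  unfolding restrict_function_def lookup_sum lookup_single when_def
  by (simp add: sum.delta' in_keys_iff twist_def)

lemma integral_section_sum:
  assumes "\<And>i. i \<in> I \<Longrightarrow> integral_section (h i)"
  shows "integral_section (\<Sum>i\<in>I. h i)"
proof -
  interpret vector_space s by (rule vector_space)
  show ?thesis
    using assms by (auto simp: integral_section_def lookup_sum scale_sum_right intro!: sum_mem)
qed

lemma restrict_section_sum:
  assumes "\<And>i. i \<in> I \<Longrightarrow> integral_section (h i)"
  shows "restrict_section pr \<pi> s q \<nu> (\<Sum>i\<in>I. h i) = (\<Sum>i\<in>I. restrict_section pr \<pi> s q \<nu> (h i))"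
proof (rule poly_mapping_eqI)
  interpret vector_space s by (rule vector_space)
  show "Poly_Mapping.lookup (restrict_section pr \<pi> s q \<nu> (\<Sum>i\<in>I. h i)) u =
      Poly_Mapping.lookup (\<Sum>i\<in>I. restrict_section pr \<pi> s q \<nu> (h i)) u" for u
    using assms by (simp add: lookup_restrict_section lookup_sum scale_sum_right q_sum integral_section_def)
qed

lemma restrict_section_add:
  assumes "integral_section h" "integral_section h'"
  shows "restrict_section pr \<pi> s q \<nu> (h + h') =
    restrict_section pr \<pi> s q \<nu> h + restrict_section pr \<pi> s q \<nu> h'"
proof (rule poly_mapping_eqI)
  interpret vector_space s by (rule vector_space)
  show "Poly_Mapping.lookup (restrict_section pr \<pi> s q \<nu> (h + h')) u =
      Poly_Mapping.lookup (restrict_section pr \<pi> s q \<nu> h + restrict_section pr \<pi> s q \<nu> h') u" for u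
    using assms by (simp add: lookup_restrict_section lookup_add scale_right_distrib q_add integral_section_def)
qed

lemma restrict_section_single:
  "restrict_section pr \<pi> s q \<nu> (Poly_Mapping.single u e) = Poly_Mapping.single u (q (s (twist u) e))"
proof (rule poly_mapping_eqI)
  interpret vector_space s by (rule vector_space)
  show "Poly_Mapping.lookup (restrict_section pr \<pi> s q \<nu> (Poly_Mapping.single u e)) w =
      Poly_Mapping.lookup (Poly_Mapping.single u (q (s (twist u) e))) w" for w
    by (simp add: lookup_restrict_section lookup_single when_def)
qed

text \<open>
  The twist is multiplicative, so it can be distributed over the factors of a convolution. Hence restriction
  is compatible with products whenever the factors are integral.
\<close>

lemma twisted_coefficient_of_act:
  "s (twist w) (Poly_Mapping.lookup (act s f h) w) =
    (\<Sum>u\<in>Poly_Mapping.keys f. s (twist u * Poly_Mapping.lookup f u)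
      (s (twist (w - u)) (Poly_Mapping.lookup h (w - u))))"
proof -
  interpret vector_space s by (rule vector_space)
  have "twist w = twist u * twist (w - u)" for u
    by (simp flip: twist_add)
  then have "twist w * c = twist u * c * twist (w - u)" for u c
    by (metis mult.assoc mult.commute)
  then have "s (twist w) (s c e) = s (twist u * c) (s (twist (w - u)) e)" for u c e
    by (metis scale_scale)
  then show ?thesis
    unfolding lookup_act_keys[OF vector_space] scale_sum_right by (intro sum.cong refl)
qed

lemma integral_section_act:
  assumes "integral_function f" "integral_section h"
  shows "integral_section (act s f h)"
  unfolding integral_section_def twisted_coefficient_of_act
proof (intro allI sum_mem, rule scale_mem)
qed (use assms in \<open>simp_all add: integral_section_def integral_function_def\<close>)

lemma restrict_section_act:
  assumes f: "integral_function f" and h: "integral_section h"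
  shows "restrict_section pr \<pi> s q \<nu> (act s f h) =
    act sg (restrict_function pr \<pi> res \<nu> f) (restrict_section pr \<pi> s q \<nu> h)"
proof (rule poly_mapping_eqI)
  fix w
  interpret vector_space sg by (rule vector_space_residue)
  have keys: "Poly_Mapping.keys (restrict_function pr \<pi> res \<nu> f) \<subseteq> Poly_Mapping.keys f"
    by (auto simp: in_keys_iff lookup_restrict_function)
  show "Poly_Mapping.lookup (restrict_section pr \<pi> s q \<nu> (act s f h)) w =
      Poly_Mapping.lookup (act sg (restrict_function pr \<pi> res \<nu> f) (restrict_section pr \<pi> s q \<nu> h)) w"
    using f h
    by (simp add: lookup_restrict_section twisted_coefficient_of_act
        lookup_act[OF vector_space_residue finite_keys keys] lookup_restrict_function
        q_sum q_scale scale_mem integral_section_def integral_function_def)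
qed

end

text \<open>
  Functions are the sections with \<open>\<Lambda> = \<O>\<close>. Results on \<open>restrict_section\<close> thereby specialize to
  \<open>restrict_function\<close>.
\<close>

sublocale component_reduction \<subseteq> scalar: component_reduction n pr val \<pi> res "(*)" "(*)" "valring val" res \<nu>
  by (intro component_reduction.intro torus_over_dvr_axioms scalar_reduction
      component_reduction_axioms.intro vertex_integral)

context component_reduction
begin

abbreviation \<rho> :: "('m \<Rightarrow>\<^sub>0 'e) \<Rightarrow> ('m \<Rightarrow>\<^sub>0 'g)" where
  "\<rho> \<equiv> restrict_section pr \<pi> s q \<nu>"

abbreviation \<psi> :: "('m \<Rightarrow>\<^sub>0 'k) \<Rightarrow> ('m \<Rightarrow>\<^sub>0 'f)" where
  "\<psi> \<equiv> restrict_function pr \<pi> res \<nu>"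

lemma restrict_function_eq: "restrict_function pr \<pi> res \<nu> f = restrict_section pr \<pi> (*) res \<nu> f"
  by (simp add: restrict_function_def restrict_section_def)

lemma integral_function_eq: "integral_function f \<longleftrightarrow> scalar.integral_section f"
  by (simp add: integral_function_def scalar.integral_section_def)

lemma restrict_function_add:
  "integral_function f \<Longrightarrow> integral_function g \<Longrightarrow> restrict_function pr \<pi> res \<nu> (f + g) =
    restrict_function pr \<pi> res \<nu> f + restrict_function pr \<pi> res \<nu> g"
  unfolding restrict_function_eq integral_function_eq by (rule scalar.restrict_section_add)

lemma restrict_function_mult:
  "integral_function f \<Longrightarrow> integral_function g \<Longrightarrow> restrict_function pr \<pi> res \<nu> (f * g) =
    restrict_function pr \<pi> res \<nu> f * restrict_function pr \<pi> res \<nu> g"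
  unfolding mult_eq_act using scalar.restrict_section_act[of f g]
  by (simp add: integral_function_eq restrict_function_eq)

lemma restrict_function_one: "restrict_function pr \<pi> res \<nu> 1 = 1"
  using scalar.restrict_section_single[of 0 1]
  by (simp add: restrict_function_eq scalar.twist_def twist_def)

end

section \<open>Restriction on one affine chart\<close>

locale component_chart = component_reduction n pr val \<pi> res s sg \<Lambda> q \<nu>
  for n and pr :: "'m::ab_group_add \<Rightarrow> 'v::real_vector \<Rightarrow> real"
    and val :: "'k::field \<Rightarrow> int" and \<pi> :: 'k and res :: "'k \<Rightarrow> 'f::field"
    and s :: "'k \<Rightarrow> 'e::ab_group_add \<Rightarrow> 'e" and sg :: "'f \<Rightarrow> 'g::ab_group_add \<Rightarrow> 'g" and \<Lambda> q \<nu> +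
  fixes \<sigma> :: "('v \<times> real) set"
  assumes height: "\<forall>(x, t)\<in>\<sigma>. 0 \<le> t" and vertex_mem: "(\<nu>, 1) \<in> \<sigma>"
begin

abbreviation R :: "('m \<Rightarrow>\<^sub>0 'k) set" where
  "R \<equiv> chart_ring pr val \<pi> \<sigma>"

abbreviation R_res :: "('m \<Rightarrow>\<^sub>0 'f) set" where
  "R_res \<equiv> chart_ring_field pr (link_proj \<nu> ` \<sigma>)"

lemma integral_function_R:
  assumes "f \<in> R"
  shows "integral_function f"
  unfolding integral_function_def
proof
  fix u
  let ?a = "Poly_Mapping.lookup f u"
  have "0 \<le> val (twist u * ?a)" if "?a \<noteq> 0"
  proof -
    have "0 \<le> pr u \<nu> + of_int (val ?a) * 1"
      using chart_ring_regular_term[OF height assms, of u] vertex_mem that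
      by (auto simp: regular_term_def)
    also have "\<dots> = of_int (val (twist u * ?a))"
      using that by (simp add: val_mult val_twist)
    finally show ?thesis by simp
  qed
  then show "twist u * ?a \<in> valring val"
    by (auto simp: valring_def)
qed

text \<open>
  \<open>f\<^sub>u\<chi>\<^sup>u\<close> survives only if \<open>val f\<^sub>u = -\<langle>u,\<nu>\<rangle>\<close>. Its regularity on \<open>\<sigma>\<close> then says that
  \<open>(u, -\<langle>u,\<nu>\<rangle>)\<close> is nonnegative on \<open>\<sigma>\<close>, that is, \<open>u\<close> is nonnegative on the projection of \<open>\<sigma>\<close>.
\<close>

lemma restrict_function_mem:
  assumes f: "f \<in> R"
  shows "restrict_function pr \<pi> res \<nu> f \<in> R_res"
  unfolding chart_ring_field_def
proof (intro CollectI ballI)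
  fix u v
  assume u: "u \<in> Poly_Mapping.keys (restrict_function pr \<pi> res \<nu> f)" and v: "v \<in> link_proj \<nu> ` \<sigma>"
  let ?a = "Poly_Mapping.lookup f u"
  have "twist u * ?a \<in> valring val" "res (twist u * ?a) \<noteq> 0"
    using integral_function_R[OF f] u
    by (auto simp: integral_function_def in_keys_iff lookup_restrict_function)
  then have a: "?a \<noteq> 0" "val (twist u * ?a) = 0"
    using res_eq_0_iff[of "twist u * ?a"] by (auto simp: valring_def)
  then have "val ?a = - val (twist u)"
    by (simp add: val_mult)
  then have val: "of_int (val ?a) = - pr u \<nu>"
    by (simp add: val_twist)
  obtain x t where xt: "(x, t) \<in> \<sigma>" "v = x - t *\<^sub>R \<nu>"
    using v by auto
  then have "0 \<le> pr u x + of_int (val ?a) * t"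
    using chart_ring_regular_term[OF height f, of u] a by (auto simp: regular_term_def)
  also have "\<dots> = pr u v"
    using linear_diff[OF pr_linear] linear_scale[OF pr_linear] by (simp add: val xt(2))
  finally show "0 \<le> pr u v" .
qed

lemma restrict_function_surj:
  assumes g: "g \<in> R_res"
  shows "\<exists>f\<in>R. restrict_function pr \<pi> res \<nu> f = g"
proof -
  have "\<forall>y. \<exists>x. x \<in> valring val \<and> res x = y"
    using res_lift by blast
  from choice[OF this] obtain lift where lift: "\<And>y. lift y \<in> valring val" "\<And>y. res (lift y) = y"
    by blast
  define f where "f = (\<Sum>u\<in>Poly_Mapping.keys g.
    Poly_Mapping.single u (inverse (twist u) * lift (Poly_Mapping.lookup g u)))"
  have lookup: "Poly_Mapping.lookup f u =
      (if u \<in> Poly_Mapping.keys g then inverse (twist u) * lift (Poly_Mapping.lookup g u) else 0)" for u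
    by (simp add: f_def lookup_sum lookup_single when_def sum.delta')
  have "restrict_function pr \<pi> res \<nu> f = g"
    by (rule poly_mapping_eqI) (auto simp: lookup_restrict_function lookup lift in_keys_iff mult.assoc[symmetric])
  moreover have "f \<in> R"
    unfolding chart_ring_iff[OF height]
  proof
    fix u
    show "regular_term \<sigma> u (Poly_Mapping.lookup f u)"
    proof (cases "u \<in> Poly_Mapping.keys g")
      case True
      let ?y = "Poly_Mapping.lookup g u"
      have "res (lift ?y) \<noteq> 0"
        using True by (simp add: lift in_keys_iff)
      then have y: "lift ?y \<noteq> 0" "val (lift ?y) = 0"
        using res_eq_0_iff[OF lift(1), of ?y] lift(1)[of ?y] by (auto simp: valring_def)
      have "val (Poly_Mapping.lookup f u) = - val (twist u)"
        using True y by (simp add: lookup val_mult val_inverse)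
      then have val: "of_int (val (Poly_Mapping.lookup f u)) = - pr u \<nu>"
        by (simp add: val_twist)
      have "0 \<le> pr u x + of_int (val (Poly_Mapping.lookup f u)) * t" if "(x, t) \<in> \<sigma>" for x t
      proof -
        have "x - t *\<^sub>R \<nu> \<in> link_proj \<nu> ` \<sigma>"
          using that by (intro image_eqI[of _ _ "(x, t)"]) auto
        then have "0 \<le> pr u (x - t *\<^sub>R \<nu>)"
          using g True unfolding chart_ring_field_def by blast
        then show ?thesis
          using linear_diff[OF pr_linear] linear_scale[OF pr_linear] by (simp add: val mult.commute)
      qed
      then show ?thesis by (auto simp: regular_term_def)
    qed (simp add: lookup regular_term_def)
  qed
  ultimately show ?thesis by blast
qed

lemma restrict_function_image: "restrict_function pr \<pi> res \<nu> ` R = R_res"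
  using restrict_function_mem restrict_function_surj by blast

end

text \<open>
  On a chart where the bundle splits, the generators \<open>\<chi>\<^bsup>-u\<^sub>i\<^esup>b\<^sub>i\<close> restrict to \<open>\<chi>\<^bsup>-u\<^sub>i\<^esup>\<close> times the classes of
  \<open>\<pi>\<^bsup>-\<langle>u\<^sub>i,\<nu>\<rangle>\<^esup>b\<^sub>i\<close>. It is assumed here that the latter vectors form a basis of \<open>\<Lambda>\<close>; this is the
  case for \<open>\<Lambda> = \<Phi>\<^sub>1(\<nu>)\<close>.
\<close>

locale split_component_chart = component_chart n pr val \<pi> res s sg \<Lambda> q \<nu> \<sigma>
  for n and pr :: "'m::ab_group_add \<Rightarrow> 'v::real_vector \<Rightarrow> real"
    and val :: "'k::field \<Rightarrow> int" and \<pi> :: 'k and res :: "'k \<Rightarrow> 'f::field"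
    and s :: "'k \<Rightarrow> 'e::ab_group_add \<Rightarrow> 'e" and sg :: "'f \<Rightarrow> 'g::ab_group_add \<Rightarrow> 'g" and \<Lambda> q \<nu> \<sigma> +
  fixes r :: nat and H :: "('m \<Rightarrow>\<^sub>0 'e) set" and b :: "nat \<Rightarrow> 'e" and u :: "nat \<Rightarrow> 'm"
  assumes lattice_reduction: "lattice_reduction val \<pi> res s sg \<Lambda> q"
    and splitting: "splitting s r (chart_ring pr val \<pi> \<sigma>) H b u"
    and lattice_basis: "lattice_basis val s r \<Lambda> (\<lambda>i. s (twist (- u i)) (b i))"
begin

definition b_res :: "nat \<Rightarrow> 'g" where
  "b_res i = q (s (twist (- u i)) (b i))"

lemma is_basis_b_res: "is_basis sg r b_res"
  using is_basis_reduction[OF lattice_reduction lattice_basis] by (simp add: b_res_def[abs_def] comp_def)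

lemma H_eq: "H = {\<Sum>i<r. act s (f i) (Poly_Mapping.single (- u i) (b i)) | f. \<forall>i<r. f i \<in> R}"
  using splitting by (simp add: splitting_def)

lemma integral_generator: "i < r \<Longrightarrow> integral_section (Poly_Mapping.single (- u i) (b i))"
proof -
  interpret vector_space s by (rule vector_space)
  show "i < r \<Longrightarrow> integral_section (Poly_Mapping.single (- u i) (b i))"
    using lattice_basis_mem[OF lattice_basis] zero_mem
    by (auto simp: integral_section_def lookup_single when_def)
qed

lemma integral_combination:
  assumes "\<forall>i<r. f i \<in> R"
  shows "integral_section (\<Sum>i<r. act s (f i) (Poly_Mapping.single (- u i) (b i)))"
  using assms
  by (intro integral_section_sum integral_section_act integral_function_R integral_generator) auto

lemma integral_H: "h \<in> H \<Longrightarrow> integral_section h"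
  using integral_combination unfolding H_eq by auto

lemma restrict_combination:
  assumes "\<forall>i<r. f i \<in> R"
  shows "\<rho> (\<Sum>i<r. act s (f i) (Poly_Mapping.single (- u i) (b i))) =
    (\<Sum>i<r. act sg (\<psi> (f i)) (Poly_Mapping.single (- u i) (b_res i)))"
  using assms
  by (subst restrict_section_sum)
    (auto simp: restrict_section_act restrict_section_single integral_section_act
      integral_function_R integral_generator b_res_def)

lemma restrict_section_act_sum:
  assumes "\<And>i. i \<in> I \<Longrightarrow> f i \<in> R" "\<And>i. i \<in> I \<Longrightarrow> h i \<in> H"
  shows "\<rho> (\<Sum>i\<in>I. act s (f i) (h i)) = (\<Sum>i\<in>I. act sg (\<psi> (f i)) (\<rho> (h i)))"
  using assms
  by (subst restrict_section_sum)
    (auto simp: restrict_section_act integral_section_act integral_function_R integral_H)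

text \<open>
  The restricted bundle splits with the same characters, because restriction of functions is surjective.
\<close>

lemma splitting_restriction: "splitting sg r R_res (\<rho> ` H) b_res u"
  unfolding splitting_def
proof (intro conjI is_basis_b_res equalityI subsetI)
  fix y assume "y \<in> \<rho> ` H"
  then obtain f where "\<forall>i<r. f i \<in> R" "y = \<rho> (\<Sum>i<r. act s (f i) (Poly_Mapping.single (- u i) (b i)))"
    unfolding H_eq by auto
  then show "y \<in> {\<Sum>i<r. act sg (f i) (Poly_Mapping.single (- u i) (b_res i)) | f. \<forall>i<r. f i \<in> R_res}"
    using restrict_combination[of f] restrict_function_mem
    by (auto intro!: exI[of _ "\<lambda>i. \<psi> (f i)"])
next
  fix y assume "y \<in> {\<Sum>i<r. act sg (f i) (Poly_Mapping.single (- u i) (b_res i)) | f. \<forall>i<r. f i \<in> R_res}"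
  then obtain g where g: "\<forall>i<r. g i \<in> R_res" "y = (\<Sum>i<r. act sg (g i) (Poly_Mapping.single (- u i) (b_res i)))"
    by auto
  have "\<forall>i. \<exists>f. i < r \<longrightarrow> f \<in> R \<and> \<psi> f = g i"
    using g(1) restrict_function_surj by blast
  from choice[OF this] obtain f where f: "\<forall>i<r. f i \<in> R" "\<forall>i<r. \<psi> (f i) = g i"
    by auto
  then have "y = \<rho> (\<Sum>i<r. act s (f i) (Poly_Mapping.single (- u i) (b i)))"
    using g(2) by (simp add: restrict_combination)
  then show "y \<in> \<rho> ` H"
    using f(1) unfolding H_eq by blast
qed

text \<open>
  The kernel is as expected because both bundles split: the coordinates of a section that restricts to \<open>0\<close>
  restrict to \<open>0\<close>.
\<close>

lemma base_change_restriction: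
  assumes H: "submodule s R H"
  shows "base_change s sg R R_res \<psi> H (\<rho> ` H) \<rho>"
  unfolding base_change_def
proof (intro conjI ballI)
  show "\<psi> (f + g) = \<psi> f + \<psi> g" "\<psi> (f * g) = \<psi> f * \<psi> g" if "f \<in> R" "g \<in> R" for f g
    using that by (simp_all add: restrict_function_add restrict_function_mult integral_function_R)
  show "\<psi> 1 = 1"
    by (rule restrict_function_one)
  show "\<psi> ` R = R_res"
    by (rule restrict_function_image)
  show "\<rho> (h + h') = \<rho> h + \<rho> h'" if "h \<in> H" "h' \<in> H" for h h'
    using that by (simp add: restrict_section_add integral_H)
  show semilinear: "\<rho> (act s f h) = act sg (\<psi> f) (\<rho> h)" if "f \<in> R" "h \<in> H" for f h
    using that by (simp add: restrict_section_act integral_H integral_function_R)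
  show "{h \<in> H. \<rho> h = 0} = combinations s {f \<in> R. \<psi> f = 0} H"
  proof (intro equalityI subsetI)
    fix h assume "h \<in> {h \<in> H. \<rho> h = 0}"
    then obtain f where f: "\<forall>i<r. f i \<in> R" and h: "h = (\<Sum>i<r. act s (f i) (Poly_Mapping.single (- u i) (b i)))"
      and zero: "\<rho> h = 0"
      unfolding H_eq by auto
    have "(\<Sum>i<r. act sg (\<psi> (f i)) (Poly_Mapping.single (- u i) (b_res i))) = 0"
      using zero by (simp add: h restrict_combination[OF f])
    then have ker: "\<psi> (f i) = 0" if "i < r" for i
      by (rule splitting_sum_eq_zeroD[OF vector_space_residue is_basis_b_res _ that])
    show "h \<in> combinations s {f \<in> R. \<psi> f = 0} H"
      unfolding h
    proof (rule act_in_combinations_sum[OF vector_space])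
      have "\<psi> 0 = 0"
        by (simp add: restrict_function_def)
      then show "0 \<in> {f \<in> R. \<psi> f = 0}"
        using height by simp
      show "f + g \<in> {f \<in> R. \<psi> f = 0}" if "f \<in> {f \<in> R. \<psi> f = 0}" "g \<in> {f \<in> R. \<psi> f = 0}" for f g
        using that by (simp add: chart_ring.add restrict_function_add integral_function_R)
      show "Poly_Mapping.single (- u i) (b i) \<in> H" if "i \<in> {..<r}" for i
        using that height by (intro splitting_generator_mem[OF vector_space splitting]) auto
    qed (use f ker in auto)
  next
    fix h assume "h \<in> combinations s {f \<in> R. \<psi> f = 0} H"
    then obtain Y f where Y: "Y \<subseteq> H" "\<And>x. x \<in> Y \<Longrightarrow> f x \<in> R \<and> \<psi> (f x) = 0" and h: "h = (\<Sum>x\<in>Y. act s (f x) x)"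
      unfolding combinations_def by blast
    have mem: "act s (f x) x \<in> H" if "x \<in> Y" for x
      using H Y that by (auto simp: submodule_def)
    have "(\<Sum>x\<in>Z. act s (f x) x) \<in> H" if "Z \<subseteq> Y" for Z
      using that
    proof (induction Z rule: infinite_finite_induct)
      case (insert x Z)
      then show ?case using H mem by (simp add: submodule_def)
    qed (use H in \<open>auto simp: submodule_def\<close>)
    moreover have "\<rho> h = (\<Sum>x\<in>Y. \<rho> (act s (f x) x))"
      unfolding h by (intro restrict_section_sum integral_H mem)
    moreover have "\<rho> (act s (f x) x) = 0" if "x \<in> Y" for x
      using semilinear[of "f x" x] Y that by (auto simp: act_zero_left)
    ultimately show "h \<in> {h \<in> H. \<rho> h = 0}"
      by (simp add: h)
  qed
qed simp

end

section \<open>The restricted bundle and its piecewise linear map\<close>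

locale toric_bundle_component = component_reduction n pr val \<pi> res s sg \<Lambda> q \<nu> +
    fan_with_vertex "lattice_NZ pr" \<Sigma> \<nu>
  for n and pr :: "'m::ab_group_add \<Rightarrow> 'v::real_vector \<Rightarrow> real"
    and val :: "'k::field \<Rightarrow> int" and \<pi> :: 'k and res :: "'k \<Rightarrow> 'f::field"
    and s :: "'k \<Rightarrow> 'e::ab_group_add \<Rightarrow> 'e" and sg :: "'f \<Rightarrow> 'g::ab_group_add \<Rightarrow> 'g" and \<Lambda> q \<nu> \<Sigma> +
  fixes r :: nat and H :: "('v \<times> real) set \<Rightarrow> ('m \<Rightarrow>\<^sub>0 'e) set" and \<Phi> :: "'v \<times> real \<Rightarrow> 'e \<Rightarrow> ereal"
  assumes toric_bundle: "toric_vector_bundle s r \<Sigma> (chart_ring pr val \<pi>) H"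
    and graded_map: "graded_map_of_bundle pr val \<pi> s r \<Sigma> H \<Phi>"
    and \<Lambda>_eq: "\<Lambda> = lattice_of (\<Phi> (\<nu>, 1))"
    and lattice_reduction: "lattice_reduction val \<pi> res s sg \<Lambda> q"
begin

abbreviation H_res :: "'v set \<Rightarrow> ('m \<Rightarrow>\<^sub>0 'g) set" where
  "H_res \<equiv> restrict_bundle pr \<pi> s q \<Sigma> \<nu> H"

abbreviation \<Phi>_link :: "'v \<Rightarrow> 'g \<Rightarrow> ereal" where
  "\<Phi>_link \<equiv> link_map val s sg r \<Lambda> q (\<lambda>x. \<Phi> (x, 1)) \<nu>"

text \<open>
  The rescaled vectors have norm \<open>0\<close> at \<open>\<nu>\<close> and are still adapted, so the unit ball of \<open>\<Phi>(\<nu>, 1)\<close> is the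
  set of their combinations with coefficients in the valuation ring.
\<close>

lemma lattice_basis_of_splitting:
  assumes b: "is_basis s r b" and adapted: "\<Phi> (\<nu>, 1) \<in> apartment val s 1 r b"
    and weights: "\<forall>i<r. \<Phi> (\<nu>, 1) (b i) = ereal (pr (u i) \<nu>)"
  shows "lattice_basis val s r \<Lambda> (\<lambda>i. s (twist (- u i)) (b i))"
proof -
  interpret vector_space s by (rule vector_space)
  define l where "l i = s (twist (- u i)) (b i)" for i
  have l: "\<Phi> (\<nu>, 1) \<in> apartment val s 1 r l"
    unfolding l_def[abs_def] by (rule apartment_rescale[OF discrete_valuation_axioms vector_space adapted]) simp
  have l_value: "\<Phi> (\<nu>, 1) (l i) = 0" if "i < r" for i
  proof -
    have "\<Phi> (\<nu>, 1) (l i) = ereal (1 * of_int (val (twist (- u i)))) + \<Phi> (\<nu>, 1) (b i)"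
      using adapted unfolding l_def apartment_def additive_norm_def by simp
    then show ?thesis
      using weights that by (simp add: val_twist zero_ereal_def)
  qed
  have "0 \<le> \<Phi> (\<nu>, 1) (\<Sum>i<r. s (c i) (l i)) \<longleftrightarrow> (\<forall>i<r. c i \<in> valring val)" for c
  proof -
    have "\<Phi> (\<nu>, 1) (\<Sum>i<r. s (c i) (l i)) =
        (INF i\<in>{i. i < r \<and> c i \<noteq> 0}. ereal (of_int (val (c i))) + \<Phi> (\<nu>, 1) (l i))"
      using l by (simp add: apartment_def)
    also have "\<dots> = (INF i\<in>{i. i < r \<and> c i \<noteq> 0}. ereal (of_int (val (c i))))"
      by (rule INF_cong) (auto simp: l_value)
    finally show ?thesis
      by (auto simp: le_INF_iff valring_def)
  qed
  note lattice = this
  have basis: "is_basis s r l"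
    unfolding is_basis_iff[OF vector_space]
  proof (intro conjI allI impI)
    fix e
    obtain c where "\<And>e. e = (\<Sum>i<r. s (c e i) (b i))"
      by (rule basis_coordinatesE[OF vector_space b]) blast
    then have "e = (\<Sum>i<r. s (c e i * inverse (twist (- u i))) (l i))"
      by (simp add: l_def mult.assoc)
    then show "\<exists>c. e = (\<Sum>i<r. s (c i) (l i))"
      by (intro exI)
  next
    fix c i assume c: "(\<Sum>i<r. s (c i) (l i)) = 0" and i: "i < r"
    have "c i * twist (- u i) = 0"
      using basis_independent[OF vector_space b _ i, of "\<lambda>i. c i * twist (- u i)"] c by (simp add: l_def)
    then show "c i = 0" by simp
  qed
  obtain c where c: "\<And>e. e = (\<Sum>i<r. s (c e i) (l i))"
    by (rule basis_coordinatesE[OF vector_space basis]) blast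
  have "\<Lambda> = {\<Sum>i<r. s (a i) (l i) | a. \<forall>i<r. a i \<in> valring val}"
  proof (intro equalityI subsetI)
    fix e assume "e \<in> \<Lambda>"
    then have "0 \<le> \<Phi> (\<nu>, 1) (\<Sum>i<r. s (c e i) (l i))"
      using c[of e] by (simp add: \<Lambda>_eq lattice_of_def)
    then have "\<forall>i<r. c e i \<in> valring val"
      by (simp only: lattice)
    then show "e \<in> {\<Sum>i<r. s (a i) (l i) | a. \<forall>i<r. a i \<in> valring val}"
      using c[of e] by blast
  qed (auto simp: \<Lambda>_eq lattice_of_def lattice)
  with basis show ?thesis
    unfolding lattice_basis_def l_def[abs_def] by blast
qed

lemma split_chartE:
  assumes \<sigma>: "\<sigma> \<in> star_cones"
  obtains b u where "split_component_chart n pr val \<pi> res s sg \<Lambda> q \<nu> \<sigma> r (H \<sigma>) b u"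
    and "\<And>x. (x, 1) \<in> \<sigma> \<Longrightarrow> \<Phi> (x, 1) \<in> apartment val s 1 r b"
    and "\<And>x i. (x, 1) \<in> \<sigma> \<Longrightarrow> i < r \<Longrightarrow> \<Phi> (x, 1) (b i) = ereal (pr (u i) x)"
proof -
  have \<sigma>': "\<sigma> \<in> \<Sigma>" "(\<nu>, 1) \<in> \<sigma>"
    using \<sigma> by (auto simp: star_cones_def)
  then obtain b u where split: "splitting s r (chart_ring pr val \<pi> \<sigma>) (H \<sigma>) b u"
    and \<Phi>: "\<forall>(x, m)\<in>\<sigma>. \<Phi> (x, m) \<in> apartment val s m r b \<and> (\<forall>i<r. \<Phi> (x, m) (b i) = ereal (pr (u i) x))"
    using graded_map unfolding graded_map_of_bundle_def by blast
  have "lattice_basis val s r \<Lambda> (\<lambda>i. s (twist (- u i)) (b i))"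
    using split \<Phi> \<sigma>'(2) by (intro lattice_basis_of_splitting) (auto simp: splitting_def)
  then have "split_component_chart n pr val \<pi> res s sg \<Lambda> q \<nu> \<sigma> r (H \<sigma>) b u"
    using \<sigma>' height split lattice_reduction by unfold_locales auto
  then show ?thesis
    using that \<Phi> by blast
qed

lemma submodule_H: "\<sigma> \<in> \<Sigma> \<Longrightarrow> submodule s (chart_ring pr val \<pi> \<sigma>) (H \<sigma>)"
  using toric_bundle by (simp add: toric_vector_bundle_def)

text \<open>
  The definite description is resolved because the projection is injective on the cones around \<open>\<nu>\<close>.
\<close>

lemma polyhedron_of_star_cone:
  assumes \<sigma>: "\<sigma> \<in> star_cones"
  shows "(THE \<Delta>. \<Delta> \<in> Sigma1 \<Sigma> \<and> \<nu> \<in> \<Delta> \<and> star_cone \<nu> \<Delta> = link_proj \<nu> ` \<sigma>) = slice 1 \<sigma>"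
proof (rule the_equality)
  have "slice 1 \<sigma> \<in> {\<Delta> \<in> Sigma1 \<Sigma>. \<nu> \<in> \<Delta>}"
    using \<sigma> unfolding polyhedra_at_vertex by blast
  then show "slice 1 \<sigma> \<in> Sigma1 \<Sigma> \<and> \<nu> \<in> slice 1 \<sigma> \<and> star_cone \<nu> (slice 1 \<sigma>) = link_proj \<nu> ` \<sigma>"
    using \<sigma> by (simp add: star_cone_slice_star)
next
  fix \<Delta> assume \<Delta>: "\<Delta> \<in> Sigma1 \<Sigma> \<and> \<nu> \<in> \<Delta> \<and> star_cone \<nu> \<Delta> = link_proj \<nu> ` \<sigma>"
  then have "\<Delta> \<in> slice 1 ` star_cones"
    by (simp flip: polyhedra_at_vertex)
  then obtain \<tau> where \<tau>: "\<tau> \<in> star_cones" "\<Delta> = slice 1 \<tau>" by blast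
  with \<Delta> have "link_proj \<nu> ` \<tau> = link_proj \<nu> ` \<sigma>"
    by (simp add: star_cone_slice_star)
  then have "\<tau> = \<sigma>"
    using link_proj_subsetD[OF \<sigma> \<tau>(1)] link_proj_subsetD[OF \<tau>(1) \<sigma>] by blast
  with \<tau> show "\<Delta> = slice 1 \<sigma>" by simp
qed

lemma H_res_eq: "\<sigma> \<in> star_cones \<Longrightarrow> H_res (link_proj \<nu> ` \<sigma>) = \<rho> ` H \<sigma>"
  by (simp add: restrict_bundle_def polyhedron_of_star_cone cone_over_slice_star)

lemma base_change_star:
  assumes "\<Delta> \<in> Sigma1 \<Sigma>" "\<nu> \<in> \<Delta>"
  shows "base_change s sg (chart_ring pr val \<pi> (cone_over \<Sigma> \<Delta>)) (chart_ring_field pr (star_cone \<nu> \<Delta>))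
    \<psi> (H (cone_over \<Sigma> \<Delta>)) (H_res (star_cone \<nu> \<Delta>)) \<rho>"
proof -
  have "\<Delta> \<in> slice 1 ` star_cones"
    using assms by (simp flip: polyhedra_at_vertex)
  then obtain \<sigma> where \<sigma>: "\<sigma> \<in> star_cones" "\<Delta> = slice 1 \<sigma>" by blast
  obtain b u where "split_component_chart n pr val \<pi> res s sg \<Lambda> q \<nu> \<sigma> r (H \<sigma>) b u"
    by (rule split_chartE[OF \<sigma>(1)]) blast
  then interpret split_component_chart n pr val \<pi> res s sg \<Lambda> q \<nu> \<sigma> r "H \<sigma>" b u .
  show ?thesis
    using base_change_restriction[OF submodule_H] \<sigma>
    by (simp add: cone_over_slice_star star_cone_slice_star H_res_eq star_cones_def)
qed

text \<open>
  \<open>(\<nu> + \<epsilon>v, 1)\<close> is a combination of \<open>(\<nu>, 1)\<close> and of a preimage \<open>(x, t)\<close> of \<open>v\<close>, with nonnegative coefficients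
  as soon as \<open>\<epsilon>t \<le> 1\<close>.
\<close>

lemma shrink_mem:
  assumes \<sigma>: "\<sigma> \<in> star_cones" and v: "v \<in> link_proj \<nu> ` \<sigma>"
  shows "\<forall>\<^sub>F \<epsilon> in at_right 0. (\<nu> + \<epsilon> *\<^sub>R v, 1) \<in> \<sigma>"
proof -
  obtain x t where xt: "(x, t) \<in> \<sigma>" "v = x - t *\<^sub>R \<nu>"
    using v by auto
  have cone: "convex_cone \<sigma>" and \<nu>: "(\<nu>, 1) \<in> \<sigma>" and t: "0 \<le> t"
    using \<sigma> xt height by (auto simp: star_cones_def convex_cone)
  have "(\<nu> + \<epsilon> *\<^sub>R v, 1) \<in> \<sigma>" if \<epsilon>: "0 < \<epsilon>" "\<epsilon> < 1 / (t + 1)" for \<epsilon>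
  proof -
    have "\<epsilon> * t \<le> 1"
      using \<epsilon> t by (simp add: field_simps)
    then have "\<epsilon> *\<^sub>R (x, t) + (1 - \<epsilon> * t) *\<^sub>R (\<nu>, 1) \<in> \<sigma>"
      using \<epsilon> by (intro convex_cone_add[OF cone] convex_cone_scaleR[OF cone] xt \<nu>) auto
    also have "\<epsilon> *\<^sub>R (x, t) + (1 - \<epsilon> * t) *\<^sub>R (\<nu>, 1) = (\<nu> + \<epsilon> *\<^sub>R v, 1)"
      by (simp add: xt(2) algebra_simps)
    finally show ?thesis .
  qed
  then show ?thesis
    using t by (intro eventually_at_rightI[of 0 "1 / (t + 1)"]) auto
qed

text \<open>
  The core of the theorem. At \<open>\<nu> + \<epsilon>v\<close> the norm of \<open>\<pi>\<^bsup>-\<langle>u\<^sub>i,\<nu>\<rangle>\<^esup>b\<^sub>i\<close> is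
  \<open>\<langle>u\<^sub>i, \<nu> + \<epsilon>v\<rangle> - \<langle>u\<^sub>i,\<nu>\<rangle> = \<epsilon>\<langle>u\<^sub>i,v\<rangle>\<close>. Hence the link map takes the value \<open>\<langle>u\<^sub>i,v\<rangle>\<close> at the class of
  this vector, and these classes together with the \<open>u\<^sub>i\<close> also split the restricted bundle.
\<close>

lemma link_map_on_star:
  assumes \<sigma>: "\<sigma> \<in> star_cones"
  obtains b u where "splitting sg r (chart_ring_field pr (link_proj \<nu> ` \<sigma>)) (H_res (link_proj \<nu> ` \<sigma>)) b u"
    and "\<And>v. v \<in> link_proj \<nu> ` \<sigma> \<Longrightarrow> \<Phi>_link v \<in> apartment_sph sg r b"
    and "\<And>v i. v \<in> link_proj \<nu> ` \<sigma> \<Longrightarrow> i < r \<Longrightarrow> \<Phi>_link v (b i) = ereal (pr (u i) v)"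
    and "\<And>v. v \<in> link_proj \<nu> ` \<sigma> \<Longrightarrow> \<forall>\<^sub>F \<epsilon> in at_right 0.
      link_identified val s sg r \<Lambda> q (\<Phi> (\<nu> + \<epsilon> *\<^sub>R v, 1)) (\<lambda>e. ereal \<epsilon> * \<Phi>_link v e)"
proof -
  obtain b u where chart: "split_component_chart n pr val \<pi> res s sg \<Lambda> q \<nu> \<sigma> r (H \<sigma>) b u"
    and adapted: "\<And>x. (x, 1) \<in> \<sigma> \<Longrightarrow> \<Phi> (x, 1) \<in> apartment val s 1 r b"
    and weights: "\<And>x i. (x, 1) \<in> \<sigma> \<Longrightarrow> i < r \<Longrightarrow> \<Phi> (x, 1) (b i) = ereal (pr (u i) x)"
    by (rule split_chartE[OF \<sigma>]) blast
  from chart interpret split_component_chart n pr val \<pi> res s sg \<Lambda> q \<nu> \<sigma> r "H \<sigma>" b u .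
  define l where "l i = s (twist (- u i)) (b i)" for i
  have l: "lattice_basis val s r \<Lambda> l"
    using lattice_basis by (simp add: l_def[abs_def])
  have b_res: "b_res = q \<circ> l"
    by (auto simp: b_res_def l_def)
  have l_value: "\<Phi> (x, 1) (l i) = ereal (pr (u i) (x - \<nu>))" if "(x, 1) \<in> \<sigma>" "i < r" for x i
  proof -
    have "\<Phi> (x, 1) (l i) = ereal (1 * of_int (val (twist (- u i)))) + \<Phi> (x, 1) (b i)"
      using adapted[OF that(1)] unfolding l_def apartment_def additive_norm_def by simp
    then show ?thesis
      using that by (simp add: val_twist weights linear_diff[OF pr_linear])
  qed
  have l_adapted: "\<Phi> (x, 1) \<in> apartment val s 1 r l" if "(x, 1) \<in> \<sigma>" for x
    unfolding l_def[abs_def]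
    by (rule apartment_rescale[OF discrete_valuation_axioms vector_space adapted[OF that]]) simp
  have local: "\<exists>\<phi>. \<Phi>_link v = \<phi> \<and> \<phi> \<in> apartment_sph sg r b_res \<and> (\<forall>i<r. \<phi> (b_res i) = ereal (pr (u i) v)) \<and>
      (\<forall>\<^sub>F \<epsilon> in at_right 0. link_identified val s sg r \<Lambda> q (\<Phi> (\<nu> + \<epsilon> *\<^sub>R v, 1)) (\<lambda>e. ereal \<epsilon> * \<phi> e))"
    if v: "v \<in> link_proj \<nu> ` \<sigma>" for v
  proof -
    obtain \<phi> where \<phi>: "\<phi> \<in> apartment_sph sg r b_res" "\<forall>i<r. \<phi> (b_res i) = ereal (pr (u i) v)"
      using ex_valuation_adapted[OF vector_space_residue is_basis_b_res, of "\<lambda>i. pr (u i) v"] by blast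
    have ident: "link_identified val s sg r \<Lambda> q (\<Phi> (\<nu> + \<epsilon> *\<^sub>R v, 1)) (\<lambda>e. ereal \<epsilon> * \<phi> e)"
      if "0 < \<epsilon>" "(\<nu> + \<epsilon> *\<^sub>R v, 1) \<in> \<sigma>" for \<epsilon>
      unfolding link_identified_def
    proof (intro exI[of _ l] conjI allI impI l l_adapted that)
      show "(\<lambda>e. ereal \<epsilon> * \<phi> e) \<in> apartment_sph sg r (q \<circ> l)"
        using apartment_sph_scale[OF \<phi>(1) that(1)] by (simp only: b_res)
      show "ereal \<epsilon> * \<phi> (q (l i)) = \<Phi> (\<nu> + \<epsilon> *\<^sub>R v, 1) (l i)" if i: "i < r" for i
        using \<phi>(2) i l_value[OF \<open>(\<nu> + \<epsilon> *\<^sub>R v, 1) \<in> \<sigma>\<close> i]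
        by (simp add: b_res linear_scale[OF pr_linear])
    qed
    have small: "\<forall>\<^sub>F \<epsilon> in at_right 0. 0 < \<epsilon> \<and> (\<nu> + \<epsilon> *\<^sub>R v, 1) \<in> \<sigma>"
      using shrink_mem[OF \<sigma> v] eventually_at_right_less by (rule eventually_conj[rotated])
    then have near: "\<forall>\<^sub>F \<epsilon> in at_right 0.
        link_identified val s sg r \<Lambda> q (\<Phi> (\<nu> + \<epsilon> *\<^sub>R v, 1)) (\<lambda>e. ereal \<epsilon> * \<phi> e)"
      by (rule eventually_mono) (use ident in blast)
    have cancel: "(\<lambda>e. ereal (inverse \<epsilon>) * (ereal \<epsilon> * \<phi> e)) = \<phi>" if "0 < \<epsilon>" for \<epsilon> :: real
      using that by (intro ext) (simp add: mult.assoc[symmetric] flip: one_ereal_def)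
    have "\<Phi>_link v = \<phi>"
      unfolding link_map_def
    proof (rule the_equality)
      show "\<forall>\<^sub>F \<epsilon> in at_right 0. \<exists>\<omega>'. link_identified val s sg r \<Lambda> q (\<Phi> (\<nu> + \<epsilon> *\<^sub>R v, 1)) \<omega>' \<and>
          \<phi> = (\<lambda>e. ereal (inverse \<epsilon>) * \<omega>' e)"
        using small
        by (rule eventually_mono) (use ident cancel in \<open>auto intro!: exI\<close>)
      fix \<phi>' assume "\<forall>\<^sub>F \<epsilon> in at_right 0. \<exists>\<omega>'. link_identified val s sg r \<Lambda> q (\<Phi> (\<nu> + \<epsilon> *\<^sub>R v, 1)) \<omega>' \<and>
          \<phi>' = (\<lambda>e. ereal (inverse \<epsilon>) * \<omega>' e)"
      then have "\<forall>\<^sub>F \<epsilon> in at_right (0::real). \<phi>' = \<phi>"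
        using small
      proof eventually_elim
        case (elim \<epsilon>)
        then obtain \<omega>' where \<omega>': "link_identified val s sg r \<Lambda> q (\<Phi> (\<nu> + \<epsilon> *\<^sub>R v, 1)) \<omega>'"
            "\<phi>' = (\<lambda>e. ereal (inverse \<epsilon>) * \<omega>' e)"
          by blast
        have "q ` \<Lambda> = UNIV"
          using lattice_reduction by (simp add: lattice_reduction_def)
        then have "\<omega>' = (\<lambda>e. ereal \<epsilon> * \<phi> e)"
          using link_identified_unique[OF _ \<omega>'(1)] ident elim(2) by blast
        then show ?case
          using \<omega>'(2) cancel elim(2) by simp
      qed
      then show "\<phi>' = \<phi>"
        by (simp add: eventually_const)
    qed
    with \<phi> near show ?thesis by blast
  qed
  show ?thesis
  proof (rule that[of b_res u])
    show "splitting sg r (chart_ring_field pr (link_proj \<nu> ` \<sigma>)) (H_res (link_proj \<nu> ` \<sigma>)) b_res u"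
      using splitting_restriction by (simp add: H_res_eq[OF \<sigma>])
  qed (use local in auto)
qed

lemma ring_field:
  "0 \<in> chart_ring_field pr \<tau>" "1 \<in> chart_ring_field pr \<tau>"
  by (auto simp: chart_ring_field_def simp flip: single_one)

lemma add_chart_ring_field:
  "f \<in> chart_ring_field pr \<tau> \<Longrightarrow> g \<in> chart_ring_field pr \<tau> \<Longrightarrow> f + g \<in> chart_ring_field pr \<tau>"
  using keys_add[of f g] unfolding chart_ring_field_def by blast

text \<open>
  Extension of scalars from \<open>\<sigma>\<close> to a face \<open>\<tau>\<close> commutes with restriction: coefficients and sections are lifted or
  restricted term by term.
\<close>

lemma restrict_combinations:
  assumes \<sigma>: "\<sigma> \<in> star_cones" and \<tau>: "\<tau> \<in> star_cones" and face: "\<tau> face_of \<sigma>"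
  shows "\<rho> ` H \<tau> = combinations sg (chart_ring_field pr (link_proj \<nu> ` \<tau>)) (\<rho> ` H \<sigma>)"
proof -
  obtain b u where "split_component_chart n pr val \<pi> res s sg \<Lambda> q \<nu> \<tau> r (H \<tau>) b u"
    by (rule split_chartE[OF \<tau>]) blast
  then interpret split_component_chart n pr val \<pi> res s sg \<Lambda> q \<nu> \<tau> r "H \<tau>" b u .
  have comb: "H \<tau> = combinations s R (H \<sigma>)"
    using toric_bundle face \<sigma> \<tau> by (simp add: toric_vector_bundle_def star_cones_def)
  have sub: "H \<sigma> \<subseteq> H \<tau>"
  proof
    fix h assume "h \<in> H \<sigma>"
    then show "h \<in> H \<tau>"
      using act_in_combinations_sum[OF vector_space, of R "{h}" "\<lambda>_. 1" "\<lambda>x. x" "H \<sigma>"] height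
      by (simp add: comb chart_ring.add act_one[OF vector_space])
  qed
  show ?thesis
  proof (intro equalityI subsetI)
    fix y assume "y \<in> \<rho> ` H \<tau>"
    then obtain Y f where Y: "finite Y" "Y \<subseteq> H \<sigma>" "f ` Y \<subseteq> R" and y: "y = \<rho> (\<Sum>x\<in>Y. act s (f x) x)"
      unfolding comb combinations_def by auto
    have "y = (\<Sum>x\<in>Y. act sg (\<psi> (f x)) (\<rho> x))"
      unfolding y using Y sub by (intro restrict_section_act_sum) auto
    also have "\<dots> \<in> combinations sg R_res (\<rho> ` H \<sigma>)"
      using Y restrict_function_mem
      by (intro act_in_combinations_sum[OF vector_space_residue] ring_field add_chart_ring_field) auto
    finally show "y \<in> combinations sg R_res (\<rho> ` H \<sigma>)" .
  next
    fix y assume "y \<in> combinations sg R_res (\<rho> ` H \<sigma>)"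
    then obtain Y g where Y: "finite Y" "Y \<subseteq> \<rho> ` H \<sigma>" "g ` Y \<subseteq> R_res" and y: "y = (\<Sum>x\<in>Y. act sg (g x) x)"
      unfolding combinations_def by auto
    have "\<forall>z. \<exists>p. z \<in> Y \<longrightarrow> fst p \<in> H \<sigma> \<and> \<rho> (fst p) = z \<and> snd p \<in> R \<and> \<psi> (snd p) = g z"
    proof
      fix z
      show "\<exists>p. z \<in> Y \<longrightarrow> fst p \<in> H \<sigma> \<and> \<rho> (fst p) = z \<and> snd p \<in> R \<and> \<psi> (snd p) = g z"
      proof (cases "z \<in> Y")
        case True
        obtain h where "h \<in> H \<sigma>" "\<rho> h = z" using Y(2) True by blast
        moreover obtain f where "f \<in> R" "\<psi> f = g z"
          using Y(3) True restrict_function_surj[of "g z"] by blast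
        ultimately show ?thesis by (intro exI[of _ "(h, f)"]) simp
      qed simp
    qed
    from choice[OF this] obtain p where p: "\<And>z. z \<in> Y \<Longrightarrow> fst (p z) \<in> H \<sigma> \<and> \<rho> (fst (p z)) = z \<and>
        snd (p z) \<in> R \<and> \<psi> (snd (p z)) = g z"
      by blast
    have "\<rho> (\<Sum>z\<in>Y. act s (snd (p z)) (fst (p z))) = (\<Sum>z\<in>Y. act sg (\<psi> (snd (p z))) (\<rho> (fst (p z))))"
      using p sub by (intro restrict_section_act_sum) auto
    also have "\<dots> = y"
      unfolding y using p by (intro sum.cong) auto
    finally have "y = \<rho> (\<Sum>z\<in>Y. act s (snd (p z)) (fst (p z)))" by simp
    moreover have "(\<Sum>z\<in>Y. act s (snd (p z)) (fst (p z))) \<in> H \<tau>"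
      unfolding comb using p Y(1) height
      by (intro act_in_combinations_sum[OF vector_space] chart_ring.add) auto
    ultimately show "y \<in> \<rho> ` H \<tau>" by blast
  qed
qed

lemma toric_vector_bundle_restriction:
  "toric_vector_bundle sg r (star \<Sigma> \<nu>) (chart_ring_field pr) H_res"
proof -
  obtain b0 u0 where ray: "split_component_chart n pr val \<pi> res s sg \<Lambda> q \<nu> vertex_ray r (H vertex_ray) b0 u0"
    by (rule split_chartE[OF vertex_ray_star]) blast
  interpret ray: split_component_chart n pr val \<pi> res s sg \<Lambda> q \<nu> vertex_ray r "H vertex_ray" b0 u0
    by (rule ray)
  have local: "submodule sg (chart_ring_field pr (link_proj \<nu> ` \<sigma>)) (\<rho> ` H \<sigma>) \<and>
      (\<forall>y\<in>\<rho> ` H \<sigma>. \<forall>w. Poly_Mapping.single w (Poly_Mapping.lookup y w) \<in> \<rho> ` H \<sigma>) \<and>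
      locally_free sg r (chart_ring_field pr (link_proj \<nu> ` \<sigma>)) (\<rho> ` H \<sigma>)"
    if \<sigma>: "\<sigma> \<in> star_cones" for \<sigma>
  proof -
    obtain b u where "split_component_chart n pr val \<pi> res s sg \<Lambda> q \<nu> \<sigma> r (H \<sigma>) b u"
      by (rule split_chartE[OF \<sigma>]) blast
    then interpret split_component_chart n pr val \<pi> res s sg \<Lambda> q \<nu> \<sigma> r "H \<sigma>" b u .
    have H: "submodule s R (H \<sigma>)"
      using \<sigma> by (intro submodule_H) (simp add: star_cones_def)
    have "submodule sg R_res (\<rho> ` H \<sigma>)"
      unfolding submodule_def
    proof (intro conjI ballI)
      have "\<rho> 0 = 0" by (simp add: restrict_section_def)
      then show "0 \<in> \<rho> ` H \<sigma>"
        using H by (force simp: submodule_def)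
      fix y assume "y \<in> \<rho> ` H \<sigma>"
      then obtain h where h: "h \<in> H \<sigma>" "y = \<rho> h" by auto
      show "y + y' \<in> \<rho> ` H \<sigma>" if y': "y' \<in> \<rho> ` H \<sigma>" for y'
      proof -
        obtain h' where h': "h' \<in> H \<sigma>" "y' = \<rho> h'" using y' by auto
        have "y + y' = \<rho> (h + h')"
          using h h' by (simp add: restrict_section_add integral_H)
        moreover have "h + h' \<in> H \<sigma>"
          using H h h' by (simp add: submodule_def)
        ultimately show ?thesis by blast
      qed
    next
      fix g y assume "g \<in> R_res" "y \<in> \<rho> ` H \<sigma>"
      then obtain f h where f: "f \<in> R" "g = \<psi> f" and h: "h \<in> H \<sigma>" "y = \<rho> h"
        using restrict_function_surj by blast
      have "act sg g y = \<rho> (act s f h)"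
        using f h by (simp add: restrict_section_act integral_H integral_function_R)
      moreover have "act s f h \<in> H \<sigma>"
        using H f h by (simp add: submodule_def)
      ultimately show "act sg g y \<in> \<rho> ` H \<sigma>" by blast
    qed
    moreover have "Poly_Mapping.single w (Poly_Mapping.lookup y w) \<in> \<rho> ` H \<sigma>" if y: "y \<in> \<rho> ` H \<sigma>" for y w
    proof -
      obtain h where h: "h \<in> H \<sigma>" "y = \<rho> h" using y by auto
      then have "Poly_Mapping.single w (Poly_Mapping.lookup h w) \<in> H \<sigma>"
        using toric_bundle \<sigma> by (simp add: toric_vector_bundle_def star_cones_def)
      moreover have "Poly_Mapping.single w (Poly_Mapping.lookup y w) = \<rho> (Poly_Mapping.single w (Poly_Mapping.lookup h w))"
        by (simp add: h(2) restrict_section_single lookup_restrict_section)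
      ultimately show ?thesis by blast
    qed
    moreover have "locally_free sg r R_res (\<rho> ` H \<sigma>)"
      by (rule locally_free_if_splitting[OF vector_space_residue splitting_restriction ring_field])
    ultimately show ?thesis by blast
  qed
  \<comment> \<open>The chart of the ray of \<open>\<nu>\<close> restricts to the torus of the component, where there
    are no conditions on the characters.\<close>
  have "chart_ring_field pr {0} = (UNIV :: ('m \<Rightarrow>\<^sub>0 'f) set)"
    by (auto simp: chart_ring_field_def linear_0[OF pr_linear])
  then have "splitting sg r UNIV (\<rho> ` H vertex_ray) ray.b_res u0"
    using ray.splitting_restriction by (simp add: link_proj_vertex_ray)
  then have UNIV: "H_res {0} = UNIV"
    using splitting_UNIV[OF vector_space_residue] H_res_eq[OF vertex_ray_star]
    by (simp add: link_proj_vertex_ray)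
  have faces: "H_res \<tau> = combinations sg (chart_ring_field pr \<tau>) (H_res \<sigma>)"
    if "\<sigma> \<in> star \<Sigma> \<nu>" "\<tau> \<in> star \<Sigma> \<nu>" "\<tau> face_of \<sigma>" for \<sigma> \<tau>
  proof -
    obtain \<sigma>' \<tau>' where "\<sigma>' \<in> star_cones" "\<sigma> = link_proj \<nu> ` \<sigma>'" "\<tau>' \<in> star_cones" "\<tau> = link_proj \<nu> ` \<tau>'"
      using \<open>\<sigma> \<in> star \<Sigma> \<nu>\<close> \<open>\<tau> \<in> star \<Sigma> \<nu>\<close> unfolding star_eq by blast
    with that(3) show ?thesis
      by (simp add: H_res_eq restrict_combinations[OF _ _ face_of_link_proj_imageD])
  qed
  show ?thesis
    unfolding toric_vector_bundle_def
    using ray.is_basis_b_res local faces UNIV by (auto simp: star_eq H_res_eq)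
qed

lemma lattice_NZ_link_proj:
  assumes "(x, t) \<in> lattice_NZ pr"
  shows "x - t *\<^sub>R \<nu> \<in> lattice_N pr"
  using assms vertex_integral
  by (auto simp: lattice_NZ_def lattice_N_def linear_diff[OF pr_linear] linear_scale[OF pr_linear])

end

theorem theorem1p2:
  fixes pr :: "'m::ab_group_add \<Rightarrow> 'v::real_vector \<Rightarrow> real" and n :: nat
    and val :: "'k::field \<Rightarrow> int" and \<pi> :: 'k and res :: "'k \<Rightarrow> 'f::field"
    and \<Sigma> :: "('v \<times> real) set set"
    and s :: "'k \<Rightarrow> 'e::ab_group_add \<Rightarrow> 'e" and r :: nat
    and H :: "('v \<times> real) set \<Rightarrow> ('m \<Rightarrow>\<^sub>0 'e) set" and \<Phi> :: "'v \<times> real \<Rightarrow> 'e \<Rightarrow> ereal"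
    and \<Phi>1 :: "'v \<Rightarrow> 'e \<Rightarrow> ereal" and \<nu> :: 'v and \<Lambda> :: "'e set"
    and sg :: "'f \<Rightarrow> 'g::ab_group_add \<Rightarrow> 'g" and q :: "'e \<Rightarrow> 'g"
    and \<Phi>\<^sub>\<nu> :: "'v \<Rightarrow> 'g \<Rightarrow> ereal" and H\<^sub>\<nu> :: "'v set \<Rightarrow> ('m \<Rightarrow>\<^sub>0 'g) set"
  assumes "dual_lattices n pr"
    and "discrete_valuation val \<pi>" and "residue_map val res"
    and "fan (lattice_NZ pr) \<Sigma>" and "\<forall>\<sigma>\<in>\<Sigma>. \<forall>(x, t)\<in>\<sigma>. 0 \<le> t"
    and "recession_cone ` Sigma1 \<Sigma> = Sigma0 \<Sigma>" and "fan (lattice_N pr) (Sigma0 \<Sigma>)"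
    and "\<forall>x. {x} \<in> Sigma1 \<Sigma> \<longrightarrow> x \<in> lattice_N pr"
    and "vector_space s"
    and "toric_vector_bundle s r \<Sigma> (chart_ring pr val \<pi>) H"
    and "graded_map_of_bundle pr val \<pi> s r \<Sigma> H \<Phi>"
    and "\<Phi>1 = (\<lambda>x. \<Phi> (x, 1))"
    and "{\<nu>} \<in> Sigma1 \<Sigma>"
    and "\<Lambda> = lattice_of (\<Phi>1 \<nu>)"
    and "vector_space sg" and "lattice_reduction val \<pi> res s sg \<Lambda> q"
    and "\<Phi>\<^sub>\<nu> = link_map val s sg r \<Lambda> q \<Phi>1 \<nu>"
    and "H\<^sub>\<nu> = restrict_bundle pr \<pi> s q \<Sigma> \<nu> H"
  shows
    "(\<forall>v\<in>\<Union>(star \<Sigma> \<nu>). \<forall>\<^sub>F \<epsilon> in at_right 0.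
        link_identified val s sg r \<Lambda> q (\<Phi>1 (\<nu> + \<epsilon> *\<^sub>R v)) (\<lambda>e. ereal \<epsilon> * \<Phi>\<^sub>\<nu> v e)) \<and>
     (\<forall>\<Delta>\<in>Sigma1 \<Sigma>. \<nu> \<in> \<Delta> \<longrightarrow>
        base_change s sg (chart_ring pr val \<pi> (cone_over \<Sigma> \<Delta>)) (chart_ring_field pr (star_cone \<nu> \<Delta>))
          (restrict_function pr \<pi> res \<nu>) (H (cone_over \<Sigma> \<Delta>)) (H\<^sub>\<nu> (star_cone \<nu> \<Delta>))
          (restrict_section pr \<pi> s q \<nu>)) \<and>
     fan (lattice_N pr) (star \<Sigma> \<nu>) \<and>
     toric_vector_bundle sg r (star \<Sigma> \<nu>) (chart_ring_field pr) H\<^sub>\<nu> \<and>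
     piecewise_linear sg r (star \<Sigma> \<nu>) \<Phi>\<^sub>\<nu> \<and>
     map_of_bundle pr sg r (star \<Sigma> \<nu>) H\<^sub>\<nu> \<Phi>\<^sub>\<nu>"
proof -
  interpret dual_lattices n pr by fact
  interpret discrete_valuation val \<pi> by fact
  interpret s: vector_space s by fact
  interpret sg: vector_space sg by fact
  interpret fan_with_vertex "lattice_NZ pr" \<Sigma> \<nu>
    by unfold_locales fact+
  have \<Lambda>: "\<Lambda> = {e. 0 \<le> \<Phi> (\<nu>, 1) e}"
    using assms(12,14) by (simp add: lattice_of_def)
  obtain b where "\<Phi> (\<nu>, 1) \<in> apartment val s 1 r b"
    using assms(11) vertex_ray_star by (fastforce simp: graded_map_of_bundle_def star_cones_def)
  then have norm: "additive_norm val s 1 (\<Phi> (\<nu>, 1))"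
    by (simp add: apartment_def)
  have mem: "0 \<in> \<Lambda>" "\<And>e e'. e \<in> \<Lambda> \<Longrightarrow> e' \<in> \<Lambda> \<Longrightarrow> e + e' \<in> \<Lambda>"
    "\<And>a e. a \<in> valring val \<Longrightarrow> e \<in> \<Lambda> \<Longrightarrow> s a e \<in> \<Lambda>"
  proof -
    have "\<Phi> (\<nu>, 1) 0 = \<infinity>"
      using norm by (simp add: additive_norm_def)
    then show zero: "0 \<in> \<Lambda>"
      by (simp add: \<Lambda>)
    show "e + e' \<in> \<Lambda>" if "e \<in> \<Lambda>" "e' \<in> \<Lambda>" for e e'
    proof -
      have "min (\<Phi> (\<nu>, 1) e) (\<Phi> (\<nu>, 1) e') \<le> \<Phi> (\<nu>, 1) (e + e')"
        using norm by (simp add: additive_norm_def)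
      with that show ?thesis by (auto simp: \<Lambda> min_def split: if_splits)
    qed
    show "s a e \<in> \<Lambda>" if "a \<in> valring val" "e \<in> \<Lambda>" for a e
    proof (cases "a = 0")
      case True
      with zero show ?thesis by simp
    next
      case False
      then have "\<Phi> (\<nu>, 1) (s a e) = ereal (of_int (val a)) + \<Phi> (\<nu>, 1) e"
        using norm by (simp add: additive_norm_def)
      with False that show ?thesis by (simp add: \<Lambda> valring_def)
    qed
  qed
  have q: "\<And>e e'. e \<in> \<Lambda> \<Longrightarrow> e' \<in> \<Lambda> \<Longrightarrow> q (e + e') = q e + q e'"
    "\<And>a e. a \<in> valring val \<Longrightarrow> e \<in> \<Lambda> \<Longrightarrow> q (s a e) = sg (res a) (q e)"
    using \<open>lattice_reduction val \<pi> res s sg \<Lambda> q\<close> by (simp_all add: lattice_reduction_def)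
  have \<nu>: "\<nu> \<in> lattice_N pr" and \<Lambda>': "\<Lambda> = lattice_of (\<Phi> (\<nu>, 1))"
    using assms(8,12-14) by simp_all
  interpret toric_bundle_component n pr val \<pi> res s sg \<Lambda> q \<nu> \<Sigma> r H \<Phi>
    by unfold_locales (rule assms \<nu> \<Lambda>' mem q; assumption)+
  have \<Phi>\<^sub>\<nu>: "\<Phi>\<^sub>\<nu> = \<Phi>_link" and H\<^sub>\<nu>: "H\<^sub>\<nu> = H_res"
    using assms(12,17,18) by simp_all
  show ?thesis
    unfolding \<Phi>\<^sub>\<nu> H\<^sub>\<nu> \<open>\<Phi>1 = (\<lambda>x. \<Phi> (x, 1))\<close>
  proof (intro conjI ballI impI)
    fix v assume "v \<in> \<Union> (star \<Sigma> \<nu>)"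
    then obtain \<sigma> where \<sigma>: "\<sigma> \<in> star_cones" "v \<in> link_proj \<nu> ` \<sigma>"
      by (auto simp: star_eq)
    then show "\<forall>\<^sub>F \<epsilon> in at_right 0.
        link_identified val s sg r \<Lambda> q (\<Phi> (\<nu> + \<epsilon> *\<^sub>R v, 1)) (\<lambda>e. ereal \<epsilon> * \<Phi>_link v e)"
      by - (rule link_map_on_star[OF \<sigma>(1)], blast)
  next
    show "base_change s sg (chart_ring pr val \<pi> (cone_over \<Sigma> \<Delta>)) (chart_ring_field pr (star_cone \<nu> \<Delta>))
        \<psi> (H (cone_over \<Sigma> \<Delta>)) (H_res (star_cone \<nu> \<Delta>)) \<rho>" if "\<Delta> \<in> Sigma1 \<Sigma>" "\<nu> \<in> \<Delta>" for \<Delta>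
      using that by (rule base_change_star)
    show "fan (lattice_N pr) (star \<Sigma> \<nu>)"
      by (rule fan_star[OF lattice_NZ_link_proj])
    show "toric_vector_bundle sg r (star \<Sigma> \<nu>) (chart_ring_field pr) H_res"
      by (rule toric_vector_bundle_restriction)
    show map: "map_of_bundle pr sg r (star \<Sigma> \<nu>) H_res \<Phi>_link"
      unfolding map_of_bundle_def star_eq ball_simps
    proof
      fix \<sigma> assume "\<sigma> \<in> star_cones"
      then show "\<exists>b u. splitting sg r (chart_ring_field pr (link_proj \<nu> ` \<sigma>)) (H_res (link_proj \<nu> ` \<sigma>)) b u \<and>
          (\<forall>x\<in>\<sigma>. \<Phi>_link (link_proj \<nu> x) \<in> apartment_sph sg r b \<and>
            (\<forall>i<r. \<Phi>_link (link_proj \<nu> x) (b i) = ereal (pr (u i) (link_proj \<nu> x))))"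
        by (rule link_map_on_star) blast
    qed
    show "piecewise_linear sg r (star \<Sigma> \<nu>) \<Phi>_link"
      unfolding piecewise_linear_def
    proof
      fix \<sigma> assume "\<sigma> \<in> star \<Sigma> \<nu>"
      then obtain b u where "is_basis sg r b"
          "\<forall>x\<in>\<sigma>. \<Phi>_link x \<in> apartment_sph sg r b \<and> (\<forall>i<r. \<Phi>_link x (b i) = ereal (pr (u i) x))"
        using map unfolding map_of_bundle_def splitting_def by blast
      then show "\<exists>b l. is_basis sg r b \<and> (\<forall>i<r. linear (l i)) \<and>
          (\<forall>x\<in>\<sigma>. \<Phi>_link x \<in> apartment_sph sg r b \<and> (\<forall>i<r. \<Phi>_link x (b i) = ereal (l i x)))"
        using pr_linear by (intro exI[of _ b] exI[of _ "\<lambda>i. pr (u i)"]) blast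
    qed
  qed
qed

end
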